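(* Let $0<\theta<1$, $1\le r<\infty$, $\alpha>0$ and $1<p<q<\infty$. Define $p_\theta$ by $\frac1{p_\theta}=\frac{1-\theta}{p}+\frac{\theta}{q}$. Then $$\bigl(L^{p),\alpha}(\Omega),\,L^{q),\alpha}(\Omega)\bigr)_{\theta,r}=L^{p_\theta,r}(\log L)^{-\frac{\alpha}{p_\theta}},$$ with equivalent norms.
   Context: $\Omega\subset\mathbb R^n$ is a bounded open set with $|\Omega|=1$; for measurable $f$ on $\Omega$, $f_*$ is the decreasing rearrangement of $|f|$ on $(0,1)$; $\log$ is the natural logarithm. Grand Lebesgue space: for $1<p<\infty$, $\alpha>0$, $L^{p),\alpha}(\Omega)$ is the set of measurable $f$ with $\|f\|_{p),\alpha}=\sup_{0<t<1}(1-\log t)^{-\alpha/p}\bigl(\int_t^1 f_*^p(\sigma)d\sigma\bigr)^{1/p}<\infty$. Lorentz–Zygmund space: for $1\le a\le\infty$, $1\le r<\infty$, $\beta\in\mathbb R$, $L^{a,r}(\log L)^{\beta}$ is the set of measurable $f$ on $\Omega$ with $\|f\|_{a,r;\beta}=\bigl(\int_0^1[t^{1/a}(1-\log t)^{\beta}f_*(t)]^r\frac{dt}{t}\bigr)^{1/r}<\infty$. K-functional of a compatible couple $(X_0,X_1)$: $K(g,t;X_0,X_1)=\inf_{g=g_0+g_1}(\|g_0\|_{X_0}+t\|g_1\|_{X_1})$. For $0<\theta<1$, $1\le r<\infty$, $(X_0,X_1)_{\theta,r}$ is the set of $g\in X_0+X_1$ with $\|g\|_{\theta,r}=\bigl(\int_0^1[t^{-\theta}K(g,t;X_0,X_1)]^r\frac{dt}{t}\bigr)^{1/r}<\infty$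 (only $t\in(0,1)$ is used). *)

theory Defs
  imports "HOL-Analysis.Analysis"
begin

text \<open>Real power of an extended nonnegative real (used only with positive exponents):
  infinity stays infinity, finite values use the real power.\<close>
definition enn_powr :: "ennreal \<Rightarrow> real \<Rightarrow> ennreal" where
  "enn_powr x a = (if x = top then top else ennreal (enn2real x powr a))"

definition meas_on :: "'a::euclidean_space set \<Rightarrow> ('a \<Rightarrow> real) set" where
  "meas_on \<Omega> = borel_measurable (lebesgue_on \<Omega>)"

definition rearr :: "'a::euclidean_space set \<Rightarrow> ('a \<Rightarrow> real) \<Rightarrow> real \<Rightarrow> real" where
  "rearr \<Omega> f t = Inf {s::real. 0 \<le> s \<and> emeasure lebesgue {x\<in>\<Omega>. s < \<bar>f x\<bar>} \<le> ennreal t}"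

definition grand_norm :: "'a::euclidean_space set \<Rightarrow> real \<Rightarrow> real \<Rightarrow> ('a \<Rightarrow> real) \<Rightarrow> ennreal" where
  "grand_norm \<Omega> p \<alpha> f =
     (SUP t\<in>{0<..<1}. ennreal ((1 - ln t) powr (- \<alpha> / p)) *
        enn_powr (\<integral>\<^sup>+\<sigma>\<in>{t..1}. ennreal (rearr \<Omega> f \<sigma> powr p) \<partial>lborel) (1 / p))"

definition grand_space :: "'a::euclidean_space set \<Rightarrow> real \<Rightarrow> real \<Rightarrow> ('a \<Rightarrow> real) set" where
  "grand_space \<Omega> p \<alpha> = {f. f \<in> meas_on \<Omega> \<and> grand_norm \<Omega> p \<alpha> f < top}"

definition LZ_norm :: "'a::euclidean_space set \<Rightarrow> real \<Rightarrow> real \<Rightarrow> real \<Rightarrow> ('a \<Rightarrow> real) \<Rightarrow> ennreal" where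
  "LZ_norm \<Omega> a r \<beta> f =
     enn_powr (\<integral>\<^sup>+t\<in>{0<..<1}.
        ennreal ((t powr (1 / a) * (1 - ln t) powr \<beta> * rearr \<Omega> f t) powr r / t) \<partial>lborel) (1 / r)"

definition LZ_space :: "'a::euclidean_space set \<Rightarrow> real \<Rightarrow> real \<Rightarrow> real \<Rightarrow> ('a \<Rightarrow> real) set" where
  "LZ_space \<Omega> a r \<beta> = {f. f \<in> meas_on \<Omega> \<and> LZ_norm \<Omega> a r \<beta> f < top}"

definition sum_space :: "'a set \<Rightarrow> ('a \<Rightarrow> real) set \<Rightarrow> ('a \<Rightarrow> real) set \<Rightarrow> ('a \<Rightarrow> real) set" where
  "sum_space \<Omega> X0 X1 = {g. \<exists>g0\<in>X0. \<exists>g1\<in>X1. \<forall>x\<in>\<Omega>. g x = g0 x + g1 x}"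

definition Kfun :: "'a set \<Rightarrow> ('a \<Rightarrow> real) set \<Rightarrow> (('a \<Rightarrow> real) \<Rightarrow> ennreal)
    \<Rightarrow> ('a \<Rightarrow> real) set \<Rightarrow> (('a \<Rightarrow> real) \<Rightarrow> ennreal) \<Rightarrow> ('a \<Rightarrow> real) \<Rightarrow> real \<Rightarrow> ennreal" where
  "Kfun \<Omega> X0 N0 X1 N1 g t =
     (INF gg\<in>{(g0, g1). g0 \<in> X0 \<and> g1 \<in> X1 \<and> (\<forall>x\<in>\<Omega>. g x = g0 x + g1 x)}.
        N0 (fst gg) + ennreal t * N1 (snd gg))"

definition interp_norm :: "'a set \<Rightarrow> ('a \<Rightarrow> real) set \<Rightarrow> (('a \<Rightarrow> real) \<Rightarrow> ennreal)
    \<Rightarrow> ('a \<Rightarrow> real) set \<Rightarrow> (('a \<Rightarrow> real) \<Rightarrow> ennreal) \<Rightarrow> real \<Rightarrow> real \<Rightarrow> ('a \<Rightarrow> real) \<Rightarrow> ennreal" where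
  "interp_norm \<Omega> X0 N0 X1 N1 \<theta> r g =
     enn_powr (\<integral>\<^sup>+t\<in>{0<..<1}.
        enn_powr (ennreal (t powr (- \<theta>)) * Kfun \<Omega> X0 N0 X1 N1 g t) r * ennreal (1 / t) \<partial>lborel) (1 / r)"

definition interp_space :: "'a set \<Rightarrow> ('a \<Rightarrow> real) set \<Rightarrow> (('a \<Rightarrow> real) \<Rightarrow> ennreal)
    \<Rightarrow> ('a \<Rightarrow> real) set \<Rightarrow> (('a \<Rightarrow> real) \<Rightarrow> ennreal) \<Rightarrow> real \<Rightarrow> real \<Rightarrow> ('a \<Rightarrow> real) set" where
  "interp_space \<Omega> X0 N0 X1 N1 \<theta> r =
     {g. g \<in> sum_space \<Omega> X0 X1 \<and> interp_norm \<Omega> X0 N0 X1 N1 \<theta> r g < top}"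

end

theory Submission
  imports Defs
begin

text \<open>With \<open>w(t) = t (1 - ln t) powr (-\<alpha>)\<close> and \<open>\<kappa> = 1/p - 1/q\<close>, sample everything at \<open>t = 2\<^sup>-\<^sup>n\<close>
  and the K-functional at \<open>\<rho> = w(t) powr \<kappa>\<close>. Since \<open>w\<close> loses a factor between \<open>2\<close> and
  \<open>2 powr (1 + \<alpha>)\<close> in each dyadic step, both norms, raised to the power \<open>r\<close>, become sums over \<open>n\<close>, and
  \<open>w powr (1/p\<theta>) = \<rho> powr (-\<theta>) * w powr (1/p)\<close>. The grand norm lies between the weak and the strong
  norm, \<open>sup w(t) powr (1/p) * f\<^sub>*(t)\<close> and \<open>(\<integral> w(t) * f\<^sub>*(t) powr p dt/t) powr (1/p)\<close>, up to constants.
  The weak bound and \<open>(g\<^sub>0 + g\<^sub>1)\<^sub>*(2t) \<le> g\<^sub>0\<^sub>*(t) + g\<^sub>1\<^sub>*(t)\<close> give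
  \<open>K(f, \<rho>) \<ge> c * w(t) powr (1/p) * f\<^sub>*(t)\<close>; the strong bound, applied to the truncation of \<open>f\<close> at
  height \<open>f\<^sub>*(t)\<close>, reduces the upper estimate to a discrete Hardy inequality with a geometric kernel.\<close>

section \<open>Powers of extended nonnegative reals and a discrete Hardy inequality\<close>

lemma enn_powr_ennreal: "0 \<le> x \<Longrightarrow> enn_powr (ennreal x) a = ennreal (x powr a)"
  by (simp add: enn_powr_def)

lemma enn_powr_top: "enn_powr top a = top"
  by (simp add: enn_powr_def)

lemma enn_powr_one: "enn_powr x 1 = x"
  by (cases x) (auto simp: enn_powr_ennreal enn_powr_top)

lemma enn_powr_mono:
  assumes "x \<le> y" "0 < a" shows "enn_powr x a \<le> enn_powr y a"
proof (cases y)
  case (real v)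
  then obtain u where "x = ennreal u" "0 \<le> u" "u \<le> v"
    using assms(1) by (cases x) (auto simp: top_unique)
  then show ?thesis
    using real assms(2) by (simp add: enn_powr_ennreal powr_mono2)
qed (simp add: enn_powr_top)

lemma enn_powr_mult:
  assumes "0 < a" shows "enn_powr (x * y) a = enn_powr x a * enn_powr y a"
  using assms
  by (cases x; cases y)
     (auto simp: enn_powr_def ennreal_mult[symmetric] enn2real_mult powr_mult ennreal_top_mult
        ennreal_mult_top ennreal_mult_eq_top_iff)

lemma enn_powr_powr:
  assumes "0 < a" "0 < b" shows "enn_powr (enn_powr x a) b = enn_powr x (a * b)"
  by (cases x) (auto simp: enn_powr_ennreal enn_powr_top powr_powr)

text \<open>The bound x + y <= 2 max x y treats exponents below and above 1 alike, where convexity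
  would point in opposite directions.\<close>

lemma enn_powr_add_le:
  assumes "0 < a"
  shows "enn_powr (x + y) a \<le> ennreal (2 powr a) * (enn_powr x a + enn_powr y a)"
proof -
  have "enn_powr (x + y) a \<le> enn_powr (ennreal 2 * max x y) a"
    by (intro enn_powr_mono assms)
      (metis add_mono ennreal_numeral max.cobounded1 max.cobounded2 mult_2 zero_le_numeral)
  also have "\<dots> = ennreal (2 powr a) * enn_powr (max x y) a"
    by (simp only: enn_powr_mult[OF assms] enn_powr_ennreal zero_le_numeral)
  also have "\<dots> \<le> ennreal (2 powr a) * (enn_powr x a + enn_powr y a)"
    by (intro mult_left_mono) (auto simp: max_def)
  finally show ?thesis .
qed

lemma enn_powr_le_cmult:
  assumes "X \<le> ennreal C * Y" "0 \<le> C" "0 < a"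
  shows "enn_powr X a \<le> ennreal (C powr a) * enn_powr Y a"
  using enn_powr_mono[OF assms(1,3)] assms by (simp add: enn_powr_mult enn_powr_ennreal)

lemma cmult_enn_powr_inverse:
  assumes "0 \<le> c" "0 < a"
  shows "ennreal c * enn_powr X (1 / a) = enn_powr (ennreal (c powr a) * X) (1 / a)"
  using assms by (simp add: enn_powr_mult enn_powr_ennreal powr_powr)

lemma suminf_ennreal_swap:
  fixes f :: "nat \<Rightarrow> nat \<Rightarrow> ennreal"
  shows "(\<Sum>n. \<Sum>k. f n k) = (\<Sum>k. \<Sum>n. f n k)"
  using nn_integral_suminf[of "\<lambda>k n. f n k" "count_space UNIV"]
  by (simp add: nn_integral_count_space_nat)

lemma suminf_ennreal_term_le:
  fixes f :: "nat \<Rightarrow> ennreal" shows "f k \<le> (\<Sum>k. f k)"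
  using sum_le_suminf[of f "{k}"] by simp

text \<open>The distance of two naturals; one of the two truncated differences vanishes.\<close>

definition ndist :: "nat \<Rightarrow> nat \<Rightarrow> nat" where
  "ndist k n = (k - n) + (n - k)"

lemma ndist_commute: "ndist k n = ndist n k"
  by (simp add: ndist_def)

lemma suminf_geometric_ndist:
  assumes "0 < x" "x < 1"
  shows "(\<Sum>k. ennreal (x powr real (ndist k n))) \<le> ennreal (2 / (1 - x))"
proof -
  let ?f = "\<lambda>k. x ^ ndist k n"
  have "(\<Sum>k<N. ?f k) \<le> 2 / (1 - x)" for N
  proof -
    \<comment> \<open>Up to the peak \<open>n\<close> the invariant is a crude geometric bound,
      beyond it 1 / (1 - x) plus an exact geometric sum. The two formulas agree at
      \<open>N = n\<close>, and both stay below 2 / (1 - x).\<close>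
    have "(\<Sum>k<N. ?f k) \<le> (if N \<le> n then x ^ (n - N) / (1 - x) else (2 - x ^ (N - n)) / (1 - x))"
    proof (induction N)
      case 0
      then show ?case using assms by simp
    next
      case (Suc N)
      consider "Suc N \<le> n" | "N = n" | "n < N" by linarith
      then show ?case
      proof cases
        case 1
        then obtain j where j: "n = Suc N + j" using le_Suc_ex by blast
        \<comment> \<open>After division by the common power x^j, the induction step reduces to this
          inequality, that is (1 - x)^2 >= 0.\<close>
        have "x + x * (1 - x) \<le> 1"
          using zero_le_power2[of "1 - x"] by (simp add: power2_eq_square algebra_simps)
        then have "(x + x * (1 - x)) / (1 - x) \<le> 1 / (1 - x)"
          using assms by (intro divide_right_mono) auto
        then have "x / (1 - x) + x \<le> 1 / (1 - x)"
          using assms by (simp add: add_divide_distrib)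
        then have "x ^ j * (x / (1 - x) + x) \<le> x ^ j * (1 / (1 - x))"
          using assms by (intro mult_left_mono) auto
        then show ?thesis
          using Suc j by (simp add: ndist_def algebra_simps)
      next
        case 2
        then show ?thesis using Suc assms by (simp add: ndist_def field_simps)
      next
        case 3
        then obtain j where "N = Suc n + j" using less_iff_Suc_add by auto
        then show ?thesis using Suc assms by (simp add: ndist_def field_simps)
      qed
    qed
    also have "\<dots> \<le> 2 / (1 - x)"
      using assms power_le_one[of x "n - N"] by (auto simp: divide_right_mono)
    finally show ?thesis .
  qed
  then have "(\<Sum>k<N. ennreal (?f k)) \<le> ennreal (2 / (1 - x))" for N
    using assms by (subst sum_ennreal) (auto simp: ennreal_leI)
  then have "(\<Sum>k. ennreal (?f k)) \<le> ennreal (2 / (1 - x))"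
    by (intro suminf_le_const) auto
  then show ?thesis
    using assms by (simp add: powr_realpow)
qed

text \<open>Half of the decay of the kernel pays for replacing a sum by its largest term, which is then
  bounded by the \<open>r\<close>-th power sum with the other half. Hence no convexity is needed and all
  \<open>p, r > 0\<close> are allowed.\<close>

lemma discrete_Hardy:
  fixes b :: "nat \<Rightarrow> real"
  assumes x: "0 < x" "x < 1" and "0 < p" "0 < r" and b: "\<And>k. 0 \<le> b k"
  shows "(\<Sum>n. enn_powr (\<Sum>k. ennreal ((x powr real (ndist k n) * b k) powr p)) (r / p))
    \<le> ennreal ((2 / (1 - x powr (p / 2))) powr (r / p) * (2 / (1 - x powr (r / 2))))
        * (\<Sum>k. ennreal (b k powr r))"
proof -
  define T where "T n = (\<Sum>k. ennreal ((x powr (real (ndist k n) / 2) * b k) powr r))" for n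
  have lt1: "x powr (a / 2) < 1" if "0 < a" for a
    using x that powr_less_mono2[of "a / 2" x 1] by simp
  define A where "A = 2 / (1 - x powr (p / 2))"
  have "0 < A" using lt1[OF \<open>0 < p\<close>] by (simp add: A_def)
  have inner: "enn_powr (\<Sum>k. ennreal ((x powr real (ndist k n) * b k) powr p)) (r / p)
      \<le> ennreal (A powr (r / p)) * T n" for n
  proof -
    have "ennreal ((x powr real (ndist k n) * b k) powr p)
        \<le> ennreal ((x powr (p / 2)) powr real (ndist k n)) * enn_powr (T n) (p / r)" for k
    proof -
      let ?y = "x powr (real (ndist k n) / 2) * b k"
      have "(x powr real (ndist k n) * b k) powr p = (x powr (p / 2)) powr real (ndist k n) * ?y powr p"
      proof -
        have "x powr (real (ndist k n) * p)
            = x powr (p / 2 * real (ndist k n)) * x powr (real (ndist k n) / 2 * p)"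
          by (simp add: powr_add[symmetric] mult.commute)
        then show ?thesis
          by (simp only: powr_mult powr_powr mult.assoc)
      qed
      moreover have "ennreal (?y powr p) = enn_powr (ennreal (?y powr r)) (p / r)"
        using \<open>0 < r\<close> by (simp add: enn_powr_ennreal powr_powr)
      moreover have "\<dots> \<le> enn_powr (T n) (p / r)"
        unfolding T_def using \<open>0 < p\<close> \<open>0 < r\<close>
        by (intro enn_powr_mono suminf_ennreal_term_le[where f = "\<lambda>k. ennreal ((x powr (real (ndist k n) / 2) * b k) powr r)"]) auto
      ultimately show ?thesis
        by (simp add: ennreal_mult mult_left_mono)
    qed
    then have "(\<Sum>k. ennreal ((x powr real (ndist k n) * b k) powr p))
        \<le> (\<Sum>k. ennreal ((x powr (p / 2)) powr real (ndist k n)) * enn_powr (T n) (p / r))"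
      by (intro suminf_le) auto
    also have "\<dots> = (\<Sum>k. ennreal ((x powr (p / 2)) powr real (ndist k n))) * enn_powr (T n) (p / r)"
      by (simp add: mult.commute)
    also have "\<dots> \<le> ennreal A * enn_powr (T n) (p / r)"
      unfolding A_def using x lt1[OF \<open>0 < p\<close>]
      by (intro mult_right_mono suminf_geometric_ndist) auto
    finally have "enn_powr (\<Sum>k. ennreal ((x powr real (ndist k n) * b k) powr p)) (r / p)
        \<le> enn_powr (ennreal A * enn_powr (T n) (p / r)) (r / p)"
      using \<open>0 < p\<close> \<open>0 < r\<close> by (intro enn_powr_mono) auto
    also have "\<dots> = ennreal (A powr (r / p)) * T n"
      using \<open>0 < p\<close> \<open>0 < r\<close> \<open>0 < A\<close>
      by (simp add: enn_powr_mult enn_powr_ennreal enn_powr_powr enn_powr_one)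
    finally show ?thesis .
  qed
  \<comment> \<open>The half of the kernel kept in \<open>T\<close> is summed over \<open>n\<close>
    after exchanging the sums; the kernel is symmetric, so the same geometric bound applies.\<close>
  have "(\<Sum>n. T n) = (\<Sum>k. \<Sum>n. ennreal ((x powr (real (ndist k n) / 2) * b k) powr r))"
    unfolding T_def by (rule suminf_ennreal_swap)
  also have "\<dots> = (\<Sum>k. ennreal (b k powr r) * (\<Sum>n. ennreal ((x powr (r / 2)) powr real (ndist n k))))"
    using x b
    by (simp add: ennreal_suminf_cmult[symmetric] powr_mult powr_powr ennreal_mult[symmetric] ndist_commute
        algebra_simps del: ennreal_suminf_cmult)
  also have "\<dots> \<le> (\<Sum>k. ennreal (b k powr r) * ennreal (2 / (1 - x powr (r / 2))))"
    using x lt1[OF \<open>0 < r\<close>] by (intro suminf_le mult_left_mono suminf_geometric_ndist) auto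
  finally have T: "(\<Sum>n. T n) \<le> ennreal (2 / (1 - x powr (r / 2))) * (\<Sum>k. ennreal (b k powr r))"
    by (simp add: mult.commute)
  have "(\<Sum>n. enn_powr (\<Sum>k. ennreal ((x powr real (ndist k n) * b k) powr p)) (r / p))
      \<le> (\<Sum>n. ennreal (A powr (r / p)) * T n)"
    by (intro suminf_le inner) auto
  also have "\<dots> \<le> ennreal (A powr (r / p)) * (ennreal (2 / (1 - x powr (r / 2))) * (\<Sum>k. ennreal (b k powr r)))"
    by (simp add: mult_left_mono T)
  also have "\<dots> = ennreal (A powr (r / p) * (2 / (1 - x powr (r / 2)))) * (\<Sum>k. ennreal (b k powr r))"
    using lt1[OF \<open>0 < r\<close>] by (subst ennreal_mult) (auto simp: mult.assoc)
  finally show ?thesis unfolding A_def .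
qed

section \<open>Dyadic step functions and the logarithmic weight\<close>

text \<open>A pointwise majorant is enough: monotonicity of the nonnegative integral holds for
  arbitrary integrands, so neither the rearrangement nor the K-functional has to be shown measurable
  in \<open>t\<close>.\<close>

lemma nn_integral_le_steps:
  fixes f :: "real \<Rightarrow> ennreal" and a :: "nat \<Rightarrow> real" and c :: "nat \<Rightarrow> ennreal"
  assumes a: "a 0 = 1" "decseq a" "a \<longlonglongrightarrow> 0"
    and f: "\<And>k x. a (Suc k) < x \<Longrightarrow> x \<le> a k \<Longrightarrow> f x \<le> c k"
    and supp: "\<And>x. x \<le> 0 \<or> 1 < x \<Longrightarrow> f x = 0"
  shows "(\<integral>\<^sup>+x. f x \<partial>lborel) \<le> (\<Sum>k. c k * ennreal (a k - a (Suc k)))"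
proof -
  have "f x \<le> (\<Sum>k. c k * indicator {a (Suc k)<..a k} x)" for x
  proof (cases "x \<le> 0 \<or> 1 < x")
    case False
    then have "\<exists>n. a n < x"
      using order_tendstoD(2)[OF a(3), of x] by (auto dest: eventually_happens)
    \<comment> \<open>The least \<open>n\<close> with \<open>a n < x\<close> is positive because
      \<open>a 0 = 1\<close>; its predecessor names the step containing \<open>x\<close>.\<close>
    then obtain n where "a n < x" "\<And>m. m < n \<Longrightarrow> x \<le> a m"
      unfolding exists_least_iff[of "\<lambda>n. a n < x"] not_less by blast
    moreover obtain k where "n = Suc k"
      using False a(1) \<open>a n < x\<close> by (cases n) auto
    ultimately have k: "a (Suc k) < x" "x \<le> a k" by auto
    have "f x \<le> c k * indicator {a (Suc k)<..a k} x"
      using k f by simp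
    also have "\<dots> \<le> (\<Sum>k. c k * indicator {a (Suc k)<..a k} x)"
      by (rule suminf_ennreal_term_le[where f = "\<lambda>k. c k * indicator {a (Suc k)<..a k} x"])
    finally show ?thesis .
  qed (simp add: supp)
  then have "(\<integral>\<^sup>+x. f x \<partial>lborel) \<le> (\<integral>\<^sup>+x. (\<Sum>k. c k * indicator {a (Suc k)<..a k} x) \<partial>lborel)"
    by (intro nn_integral_mono)
  also have "\<dots> = (\<Sum>k. c k * ennreal (a k - a (Suc k)))"
    using a(2) by (simp add: nn_integral_suminf nn_integral_cmult_indicator decseq_Suc_iff)
  finally show ?thesis .
qed

text \<open>Open steps suffice, since the division points form a null set. They also keep the point
  1, which the integrals over (0,1) omit, out of the pointwise hypothesis.\<close>

lemma steps_le_nn_integral: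
  fixes f :: "real \<Rightarrow> ennreal" and a :: "nat \<Rightarrow> real" and c :: "nat \<Rightarrow> ennreal"
  assumes a: "decseq a"
    and f: "\<And>k x. a (Suc k) < x \<Longrightarrow> x < a k \<Longrightarrow> c k \<le> f x"
  shows "(\<Sum>k. c k * ennreal (a k - a (Suc k))) \<le> (\<integral>\<^sup>+x. f x \<partial>lborel)"
proof -
  have disj: "disjoint_family (\<lambda>k. {a (Suc k)<..<a k})"
  proof -
    have "{a (Suc m)<..<a m} \<inter> {a (Suc n)<..<a n} = {}" if "m < n" for m n
      using decseqD[OF a, of "Suc m" n] that by auto
    then show ?thesis
      unfolding disjoint_family_on_def by (metis inf_commute nat_neq_iff)
  qed
  have "(\<Sum>k. c k * indicator {a (Suc k)<..<a k} x) \<le> f x" for x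
  proof (cases "\<exists>k. x \<in> {a (Suc k)<..<a k}")
    case True
    then obtain k where "x \<in> {a (Suc k)<..<a k}" by blast
    then show ?thesis
      using suminf_cmult_indicator[OF disj, of x k c] f by simp
  next
    case False
    then have "(\<Sum>k. c k * indicator {a (Suc k)<..<a k} x) = (\<Sum>k. 0)"
      by (intro arg_cong[where f = suminf]) (auto simp: indicator_def)
    then show ?thesis by simp
  qed
  then have "(\<integral>\<^sup>+x. (\<Sum>k. c k * indicator {a (Suc k)<..<a k} x) \<partial>lborel) \<le> (\<integral>\<^sup>+x. f x \<partial>lborel)"
    by (intro nn_integral_mono)
  moreover have "(\<integral>\<^sup>+x. (\<Sum>k. c k * indicator {a (Suc k)<..<a k} x) \<partial>lborel)
      = (\<Sum>k. c k * ennreal (a k - a (Suc k)))"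
    using a by (simp add: nn_integral_suminf nn_integral_cmult_indicator decseq_Suc_iff)
  ultimately show ?thesis by simp
qed

section \<open>The logarithmic weight and its decay along dyadic points\<close>

definition wt :: "real \<Rightarrow> real \<Rightarrow> real" where
  "wt \<alpha> t = t * (1 - ln t) powr (- \<alpha>)"

lemma ln_nonpos_unit: "0 < t \<Longrightarrow> t \<le> 1 \<Longrightarrow> ln t \<le> (0::real)"
  using ln_le_zero_iff by blast

lemma wt_pos: "0 < t \<Longrightarrow> t \<le> 1 \<Longrightarrow> 0 < wt \<alpha> t"
proof -
  assume "0 < t" "t \<le> 1"
  then have "1 - ln t \<noteq> 0" using ln_nonpos_unit[of t] by linarith
  then show ?thesis using \<open>0 < t\<close> by (simp add: wt_def)
qed

lemma wt_powr:
  assumes "0 < t" "t \<le> 1" shows "wt \<alpha> t powr a = t powr a * (1 - ln t) powr (- \<alpha> * a)"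
  using assms by (simp add: wt_def powr_mult powr_powr)

lemma log_weight_mono:
  fixes s t \<alpha> :: real
  assumes "0 < s" "s \<le> t" "t \<le> 1" "0 \<le> \<alpha>"
  shows "(1 - ln s) powr (- \<alpha>) \<le> (1 - ln t) powr (- \<alpha>)"
proof -
  have "ln s \<le> ln t" "ln t \<le> 0" using assms by auto
  then show ?thesis using assms by (intro powr_mono2') linarith+
qed

lemma wt_mono:
  assumes "0 < s" "s \<le> t" "t \<le> 1" "0 \<le> \<alpha>" shows "wt \<alpha> s \<le> wt \<alpha> t"
  unfolding wt_def using assms log_weight_mono[OF assms] by (intro mult_mono) auto

lemma wt_half_le:
  assumes "0 < t" "t \<le> 1" "0 \<le> \<alpha>" shows "wt \<alpha> (t / 2) \<le> wt \<alpha> t / 2"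
  using log_weight_mono[of "t / 2" t \<alpha>] assms by (simp add: wt_def)

text \<open>Since ln 2 <= 1, halving \<open>t\<close> at most doubles 1 - ln t: the linear factor
  costs 2 and the logarithmic factor at most 2^\<alpha>.\<close>

lemma wt_half_ge:
  assumes "0 < t" "t \<le> 1" "0 \<le> \<alpha>" shows "wt \<alpha> t \<le> 2 powr (1 + \<alpha>) * wt \<alpha> (t / 2)"
proof -
  have "ln t \<le> 0" "ln (2::real) \<le> 1" "ln (t / 2) = ln t - ln 2" "0 \<le> ln (2::real)"
    using assms ln_add_one_self_le_self[of 1] by (auto simp: ln_divide_pos)
  then have scaled: "1 - ln (t / 2) \<le> 2 * (1 - ln t)"
    unfolding right_diff_distrib by linarith
  have "(2 * (1 - ln t)) powr (- \<alpha>) \<le> (1 - ln (t / 2)) powr (- \<alpha>)"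
    using assms \<open>ln t \<le> 0\<close> \<open>0 \<le> ln 2\<close> \<open>ln (t / 2) = ln t - ln 2\<close>
    by (intro powr_mono2' scaled) linarith+
  then have "2 powr (- \<alpha>) * (1 - ln t) powr (- \<alpha>) \<le> (1 - ln (t / 2)) powr (- \<alpha>)"
    by (simp only: powr_mult)
  then have "(1 - ln t) powr (- \<alpha>) \<le> 2 powr \<alpha> * (1 - ln (t / 2)) powr (- \<alpha>)"
    by (simp add: powr_minus_divide[of 2] field_simps)
  then have "t * (1 - ln t) powr (- \<alpha>) \<le> t * (2 powr \<alpha> * (1 - ln (t / 2)) powr (- \<alpha>))"
    using assms by (intro mult_left_mono) auto
  then show ?thesis
    by (simp add: wt_def powr_add mult_ac)
qed

abbreviation dy :: "nat \<Rightarrow> real" where "dy k \<equiv> (1 / 2) ^ k"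

lemma dy_unit: "0 < dy k" "dy k \<le> 1"
  by (simp_all add: power_le_one)

lemma decseq_dy: "decseq dy"
  by (simp add: decseq_Suc_iff)

lemma dy_tendsto: "dy \<longlonglongrightarrow> 0"
  by (simp add: LIMSEQ_realpow_zero)

lemma wt_dy_pos: "0 < wt \<alpha> (dy k)"
  by (intro wt_pos dy_unit)

lemma wt_dy_Suc_ge: "0 \<le> \<alpha> \<Longrightarrow> wt \<alpha> (dy k) \<le> 2 powr (1 + \<alpha>) * wt \<alpha> (dy (Suc k))"
  using wt_half_ge[OF dy_unit] by simp

text \<open>Source of the geometric decay: it is passed on to \<open>\<rho>\<close> and hence to the
  Hardy kernels, and it gives the tail series in \<open>low_part_le\<close>.\<close>

lemma wt_dy_add_le:
  assumes "0 \<le> \<alpha>" shows "wt \<alpha> (dy (k + j)) \<le> dy j * wt \<alpha> (dy k)"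
proof (induction j)
  case (Suc j)
  have "wt \<alpha> (dy (k + Suc j)) \<le> wt \<alpha> (dy (k + j)) / 2"
    using wt_half_le[OF dy_unit assms, of "k + j"] by simp
  then show ?case using Suc by simp
qed simp

text \<open>This pays for the index shifts by two and three that arise in the comparisons of
  \<open>LZ_integral_ge\<close> and \<open>interp_integral_ge\<close>.\<close>

lemma wt_dy_add_ge:
  assumes "0 \<le> \<alpha>" shows "wt \<alpha> (dy k) \<le> 2 powr (real j * (1 + \<alpha>)) * wt \<alpha> (dy (k + j))"
proof (induction j)
  case (Suc j)
  have "wt \<alpha> (dy k) \<le> 2 powr (real j * (1 + \<alpha>)) * wt \<alpha> (dy (k + j))"
    by (rule Suc)
  also have "\<dots> \<le> 2 powr (real j * (1 + \<alpha>)) * (2 powr (1 + \<alpha>) * wt \<alpha> (dy (Suc (k + j))))"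
    by (intro mult_left_mono wt_dy_Suc_ge assms) auto
  also have "\<dots> = 2 powr (real j * (1 + \<alpha>) + (1 + \<alpha>)) * wt \<alpha> (dy (Suc (k + j)))"
    by (simp only: powr_add mult.assoc)
  also have "real j * (1 + \<alpha>) + (1 + \<alpha>) = real (Suc j) * (1 + \<alpha>)"
    by (simp add: algebra_simps)
  finally show ?case by simp
qed simp

lemma wt_one: "wt \<alpha> 1 = 1"
  by (simp add: wt_def)

lemma decseq_wt_dy: "0 \<le> \<alpha> \<Longrightarrow> decseq (\<lambda>k. wt \<alpha> (dy k))"
  unfolding decseq_Suc_iff by (intro allI wt_mono) (auto simp: power_le_one)

lemma wt_dy_tendsto: 
  assumes "0 \<le> \<alpha>" shows "(\<lambda>k. wt \<alpha> (dy k)) \<longlonglongrightarrow> 0"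
proof (rule tendsto_sandwich[OF _ _ tendsto_const dy_tendsto])
  show "\<forall>\<^sub>F k in sequentially. wt \<alpha> (dy k) \<le> dy k"
    using wt_dy_add_le[OF assms, of 0] by (simp add: wt_one)
  show "\<forall>\<^sub>F k in sequentially. 0 \<le> wt \<alpha> (dy k)"
    using wt_dy_pos[of \<alpha>] by (simp add: less_imp_le)
qed

section \<open>Decreasing rearrangements and truncation\<close>

definition rearr_levels :: "'a::euclidean_space set \<Rightarrow> ('a \<Rightarrow> real) \<Rightarrow> real \<Rightarrow> real set" where
  "rearr_levels \<Omega> f t = {s. 0 \<le> s \<and> emeasure lebesgue {x\<in>\<Omega>. s < \<bar>f x\<bar>} \<le> ennreal t}"

lemma rearr_eq: "rearr \<Omega> f t = Inf (rearr_levels \<Omega> f t)"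
  by (simp add: rearr_def rearr_levels_def)

lemma bdd_below_rearr_levels: "bdd_below (rearr_levels \<Omega> f t)"
  by (rule bdd_belowI[of _ 0]) (simp add: rearr_levels_def)

lemma rearr_le: "s \<in> rearr_levels \<Omega> f t \<Longrightarrow> rearr \<Omega> f t \<le> s"
  unfolding rearr_eq by (intro cInf_lower bdd_below_rearr_levels)

locale unit_domain =
  fixes \<Omega> :: "'a::euclidean_space set"
  assumes sets_domain: "\<Omega> \<in> sets lebesgue" and emeasure_domain: "emeasure lebesgue \<Omega> = 1"
begin

lemma sets_superlevel:
  assumes "f \<in> meas_on \<Omega>" shows "{x\<in>\<Omega>. s < \<bar>f x\<bar>} \<in> sets lebesgue"
proof -
  have f: "f \<in> borel_measurable (lebesgue_on \<Omega>)"
    using assms by (simp add: meas_on_def)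
  have "{x \<in> space (lebesgue_on \<Omega>). s < \<bar>f x\<bar>} \<in> sets (lebesgue_on \<Omega>)"
    using f by measurable
  then show ?thesis
    using sets_domain by (simp add: sets_restrict_space_iff space_restrict_space)
qed

lemma emeasure_superlevel_le_1: "emeasure lebesgue {x\<in>\<Omega>. s < \<bar>f x\<bar>} \<le> 1"
  using emeasure_mono[of "{x\<in>\<Omega>. s < \<bar>f x\<bar>}" \<Omega> lebesgue] sets_domain emeasure_domain by auto

lemma emeasure_superlevel_mono:
  assumes "g \<in> meas_on \<Omega>" "\<And>x. x \<in> \<Omega> \<Longrightarrow> s < \<bar>f x\<bar> \<Longrightarrow> u < \<bar>g x\<bar>"
  shows "emeasure lebesgue {x\<in>\<Omega>. s < \<bar>f x\<bar>} \<le> emeasure lebesgue {x\<in>\<Omega>. u < \<bar>g x\<bar>}"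
  using assms by (intro emeasure_mono sets_superlevel) auto

text \<open>The superlevel sets at integer levels decrease to the empty set because \<open>f\<close>
  is real valued, and they have finite measure, so their measures tend to 0. Without an admissible
  level the real infimum would carry no information.\<close>

lemma rearr_levels_nonempty:
  assumes f: "f \<in> meas_on \<Omega>" and "0 < t" shows "rearr_levels \<Omega> f t \<noteq> {}"
proof -
  let ?A = "\<lambda>n::nat. {x\<in>\<Omega>. real n < \<bar>f x\<bar>}"
  have "(\<lambda>n. emeasure lebesgue (?A n)) \<longlonglongrightarrow> emeasure lebesgue (\<Inter>n. ?A n)"
  proof (rule Lim_emeasure_decseq)
    show "range ?A \<subseteq> sets lebesgue" using sets_superlevel[OF f] by auto
    show "decseq ?A" by (force simp: decseq_def)
    show "emeasure lebesgue (?A n) \<noteq> \<infinity>" for n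
      using emeasure_superlevel_le_1[of "real n" f] by (auto simp: top_unique)
  qed
  moreover have "\<exists>n. \<not> real n < \<bar>f x\<bar>" for x
    using reals_Archimedean2[of "\<bar>f x\<bar>"] less_asym by blast
  then have "(\<Inter>n. ?A n) = {}" by blast
  ultimately have "(\<lambda>n. emeasure lebesgue (?A n)) \<longlonglongrightarrow> 0" by simp
  then have "\<forall>\<^sub>F n in sequentially. emeasure lebesgue (?A n) < ennreal t"
    using \<open>0 < t\<close> by (intro order_tendstoD) auto
  then obtain n where "emeasure lebesgue (?A n) < ennreal t"
    by (auto simp: eventually_sequentially)
  then have "real n \<in> rearr_levels \<Omega> f t"
    by (simp add: rearr_levels_def)
  then show ?thesis by blast
qed

lemma rearr_nonneg:
  assumes "f \<in> meas_on \<Omega>" "0 < t" shows "0 \<le> rearr \<Omega> f t"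
  unfolding rearr_eq using rearr_levels_nonempty[OF assms]
  by (intro cInf_greatest) (auto simp: rearr_levels_def)

text \<open>Total mass 1 makes the level 0 admissible at 1. The value is used for
  \<open>n = 0\<close> in \<open>low_part_le\<close>, where the truncation height is the
  rearrangement at 1.\<close>

lemma rearr_one: "rearr \<Omega> f 1 = 0"
proof -
  have "0 \<in> rearr_levels \<Omega> f 1"
    using emeasure_superlevel_le_1[of 0 f] by (simp add: rearr_levels_def)
  moreover have "s \<in> rearr_levels \<Omega> f 1 \<Longrightarrow> 0 \<le> s" for s
    by (simp add: rearr_levels_def)
  ultimately show ?thesis
    unfolding rearr_eq by (metis cInf_eq_minimum)
qed

lemma rearr_antimono:
  assumes "f \<in> meas_on \<Omega>" "0 < s" "s \<le> t" shows "rearr \<Omega> f t \<le> rearr \<Omega> f s"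
  unfolding rearr_eq
proof (intro cInf_superset_mono rearr_levels_nonempty assms(1,2) bdd_below_rearr_levels)
  show "rearr_levels \<Omega> f s \<subseteq> rearr_levels \<Omega> f t"
    using assms(3) by (auto simp: rearr_levels_def intro: order_trans ennreal_leI)
qed

lemma rearr_mono:
  assumes "g \<in> meas_on \<Omega>" "0 < t" "\<And>x. x \<in> \<Omega> \<Longrightarrow> \<bar>f x\<bar> \<le> \<bar>g x\<bar>"
  shows "rearr \<Omega> f t \<le> rearr \<Omega> g t"
  unfolding rearr_eq
proof (intro cInf_superset_mono rearr_levels_nonempty assms(1,2) bdd_below_rearr_levels subsetI)
  fix s assume "s \<in> rearr_levels \<Omega> g t"
  moreover have "emeasure lebesgue {x\<in>\<Omega>. s < \<bar>f x\<bar>} \<le> emeasure lebesgue {x\<in>\<Omega>. s < \<bar>g x\<bar>}"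
    using assms(3) by (intro emeasure_superlevel_mono assms(1)) force
  ultimately show "s \<in> rearr_levels \<Omega> f t"
    by (auto simp: rearr_levels_def)
qed

text \<open>If |h| > u + v then |f| > u or |g| > v, so admissible levels add up by subadditivity of
  the measure; the epsilon accounts for levels that are merely close to the infima.\<close>

lemma rearr_add:
  assumes f: "f \<in> meas_on \<Omega>" and g: "g \<in> meas_on \<Omega>" and t: "0 < s" "0 < t"
    and h: "\<And>x. x \<in> \<Omega> \<Longrightarrow> h x = f x + g x"
  shows "rearr \<Omega> h (s + t) \<le> rearr \<Omega> f s + rearr \<Omega> g t"
proof (rule field_le_epsilon)
  fix e :: real assume "0 < e"
  obtain u where u: "u \<in> rearr_levels \<Omega> f s" "u < rearr \<Omega> f s + e / 2"
    using cInf_lessD[OF rearr_levels_nonempty[OF f t(1)], of "rearr \<Omega> f s + e / 2"] \<open>0 < e\<close>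
    by (auto simp: rearr_eq)
  obtain v where v: "v \<in> rearr_levels \<Omega> g t" "v < rearr \<Omega> g t + e / 2"
    using cInf_lessD[OF rearr_levels_nonempty[OF g t(2)], of "rearr \<Omega> g t + e / 2"] \<open>0 < e\<close>
    by (auto simp: rearr_eq)
  have "emeasure lebesgue {x\<in>\<Omega>. u + v < \<bar>h x\<bar>}
      \<le> emeasure lebesgue ({x\<in>\<Omega>. u < \<bar>f x\<bar>} \<union> {x\<in>\<Omega>. v < \<bar>g x\<bar>})"
    using h by (intro emeasure_mono sets.Un sets_superlevel f g) (auto simp: not_less; linarith)
  also have "\<dots> \<le> emeasure lebesgue {x\<in>\<Omega>. u < \<bar>f x\<bar>} + emeasure lebesgue {x\<in>\<Omega>. v < \<bar>g x\<bar>}"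
    by (intro emeasure_subadditive sets_superlevel f g)
  also have "\<dots> \<le> ennreal s + ennreal t"
    using u(1) v(1) by (auto simp: rearr_levels_def intro: add_mono)
  finally have "u + v \<in> rearr_levels \<Omega> h (s + t)"
    using u(1) v(1) t by (simp add: rearr_levels_def)
  from rearr_le[OF this] show "rearr \<Omega> h (s + t) \<le> rearr \<Omega> f s + rearr \<Omega> g t + e"
    using u(2) v(2) by simp
qed

text \<open>Continuity from below: the superlevel set at height c =
  \<open>rearr \<Omega> f t\<close> is the increasing union of those at c + 1 / (n + 1), each of
  which lies above an admissible level. So the infimum is attained.\<close>

lemma emeasure_superlevel_rearr:
  assumes f: "f \<in> meas_on \<Omega>" and t: "0 < t"
  shows "emeasure lebesgue {x\<in>\<Omega>. rearr \<Omega> f t < \<bar>f x\<bar>} \<le> ennreal t"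
proof -
  let ?c = "rearr \<Omega> f t"
  let ?A = "\<lambda>n::nat. {x\<in>\<Omega>. ?c + 1 / real (Suc n) < \<bar>f x\<bar>}"
  have "emeasure lebesgue (?A n) \<le> ennreal t" for n
  proof -
    obtain u where u: "u \<in> rearr_levels \<Omega> f t" "u < ?c + 1 / real (Suc n)"
      using cInf_lessD[OF rearr_levels_nonempty[OF f t], of "?c + 1 / real (Suc n)"]
      by (auto simp: rearr_eq)
    have "emeasure lebesgue (?A n) \<le> emeasure lebesgue {x\<in>\<Omega>. u < \<bar>f x\<bar>}"
      using u(2) by (intro emeasure_superlevel_mono f) linarith
    then show ?thesis using u(1) by (auto simp: rearr_levels_def)
  qed
  moreover have "(SUP n. emeasure lebesgue (?A n)) = emeasure lebesgue (\<Union>n. ?A n)"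
  proof (rule SUP_emeasure_incseq)
    show "range ?A \<subseteq> sets lebesgue" using sets_superlevel[OF f] by auto
    have "1 / real (Suc n) \<le> 1 / real (Suc m)" if "m \<le> n" for m n
      using that by (simp add: frac_le)
    then show "incseq ?A" by (fastforce simp: incseq_def)
  qed
  moreover have "(\<Union>n. ?A n) = {x\<in>\<Omega>. ?c < \<bar>f x\<bar>}"
  proof -
    have "\<exists>n. ?c + 1 / real (Suc n) < y" if "?c < y" for y
      using reals_Archimedean[of "y - ?c"] that by (auto simp: inverse_eq_divide algebra_simps)
    moreover have "?c < y" if "?c + 1 / real (Suc n) < y" for n y
      using that by (smt (verit) divide_nonneg_nonneg of_nat_0_le_iff)
    ultimately show ?thesis by blast
  qed
  ultimately show ?thesis by (metis (no_types, lifting) SUP_least)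
qed

section \<open>Truncation at the height of the rearrangement\<close>

definition trunc_low :: "('a \<Rightarrow> real) \<Rightarrow> real \<Rightarrow> 'a \<Rightarrow> real" where
  "trunc_low f t x = max (- rearr \<Omega> f t) (min (rearr \<Omega> f t) (f x))"

definition trunc_high :: "('a \<Rightarrow> real) \<Rightarrow> real \<Rightarrow> 'a \<Rightarrow> real" where
  "trunc_high f t x = f x - trunc_low f t x"

lemma meas_on_trunc:
  assumes "f \<in> meas_on \<Omega>"
  shows "trunc_low f t \<in> meas_on \<Omega>" "trunc_high f t \<in> meas_on \<Omega>"
  using assms unfolding meas_on_def trunc_low_def trunc_high_def by measurable

lemma abs_trunc_le:
  assumes "f \<in> meas_on \<Omega>" "0 < t"
  shows "\<bar>trunc_low f t x\<bar> \<le> \<bar>f x\<bar>" "\<bar>trunc_high f t x\<bar> \<le> \<bar>f x\<bar>" "\<bar>trunc_low f t x\<bar> \<le> rearr \<Omega> f t"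
  using rearr_nonneg[OF assms] by (auto simp: trunc_low_def trunc_high_def max_def min_def)

lemma rearr_trunc_low_le:
  assumes "f \<in> meas_on \<Omega>" "0 < t" "0 < s"
  shows "rearr \<Omega> (trunc_low f t) s \<le> rearr \<Omega> f s" "rearr \<Omega> (trunc_low f t) s \<le> rearr \<Omega> f t"
proof -
  show "rearr \<Omega> (trunc_low f t) s \<le> rearr \<Omega> f s"
    by (intro rearr_mono assms abs_trunc_le)
  have *: "{x\<in>\<Omega>. rearr \<Omega> f t < \<bar>trunc_low f t x\<bar>} = {}"
    using abs_trunc_le(3)[OF assms(1,2)] by (auto simp: not_less)
  then show "rearr \<Omega> (trunc_low f t) s \<le> rearr \<Omega> f t"
    using rearr_nonneg[OF assms(1,2)] by (intro rearr_le) (simp only: rearr_levels_def mem_Collect_eq *, simp)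
qed

lemma rearr_trunc_high_le:
  assumes "f \<in> meas_on \<Omega>" "0 < t" "0 < s"
  shows "rearr \<Omega> (trunc_high f t) s \<le> rearr \<Omega> f s"
  by (intro rearr_mono assms abs_trunc_le)

text \<open>The upper part lives only where |f| exceeds its rearrangement at \<open>t\<close>, a set
  of measure at most \<open>t\<close>, so the level 0 is admissible for every s >= t.\<close>

lemma rearr_trunc_high_eq_0:
  assumes "f \<in> meas_on \<Omega>" "0 < t" "t \<le> s"
  shows "rearr \<Omega> (trunc_high f t) s = 0"
proof -
  have "emeasure lebesgue {x\<in>\<Omega>. 0 < \<bar>trunc_high f t x\<bar>} \<le> emeasure lebesgue {x\<in>\<Omega>. rearr \<Omega> f t < \<bar>f x\<bar>}"
    using rearr_nonneg[OF assms(1,2)]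
    by (intro emeasure_superlevel_mono assms(1)) (auto simp: trunc_low_def trunc_high_def max_def min_def split: if_splits)
  also have "\<dots> \<le> ennreal s"
    using emeasure_superlevel_rearr[OF assms(1,2)] assms(3) by (meson ennreal_leI order_trans)
  finally have "rearr \<Omega> (trunc_high f t) s \<le> 0"
    by (intro rearr_le) (simp add: rearr_levels_def)
  moreover have "0 \<le> rearr \<Omega> (trunc_high f t) s"
    using assms by (intro rearr_nonneg meas_on_trunc) auto
  ultimately show ?thesis by simp
qed

end

section \<open>Dyadic estimates of the norms\<close>

context unit_domain
begin

text \<open>The logarithmic factor increases in its argument, so for t <= 2^(-k) its value at
  \<open>t\<close> may be replaced by that at 2^(-k) inside the dyadic sum. The result is
  independent of \<open>t\<close> and bounds the supremum.\<close>

lemma grand_norm_le: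
  assumes f: "f \<in> meas_on \<Omega>" and "0 \<le> \<alpha>" "0 < p"
  shows "grand_norm \<Omega> p \<alpha> f
    \<le> enn_powr (\<Sum>k. ennreal (wt \<alpha> (dy k) * rearr \<Omega> f (dy (Suc k)) powr p)) (1 / p)"
  unfolding grand_norm_def
proof (rule SUP_least)
  fix t :: real assume t: "t \<in> {0<..<1}"
  let ?S = "\<Sum>k. ennreal (wt \<alpha> (dy k) * rearr \<Omega> f (dy (Suc k)) powr p)"
  let ?I = "\<integral>\<^sup>+\<sigma>\<in>{t..1}. ennreal (rearr \<Omega> f \<sigma> powr p) \<partial>lborel"
  let ?L = "(1 - ln t) powr (- \<alpha>)"
  \<comment> \<open>Steps wholly to the left of \<open>t\<close> contribute nothing, which leaves
    exactly those where the logarithmic factors can be compared.\<close>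
  define c where "c k = (if t \<le> dy k then ennreal (rearr \<Omega> f (dy (Suc k)) powr p) else 0)" for k
  have "?I \<le> (\<Sum>k. c k * ennreal (dy k - dy (Suc k)))"
  proof (rule nn_integral_le_steps[OF _ decseq_dy dy_tendsto])
    fix k x assume x: "dy (Suc k) < x" "x \<le> dy k"
    have "rearr \<Omega> f x powr p \<le> rearr \<Omega> f (dy (Suc k)) powr p"
      using x \<open>0 < p\<close> dy_unit(1)[of "Suc k"]
      by (intro powr_mono2 rearr_antimono rearr_nonneg f) auto
    then show "ennreal (rearr \<Omega> f x powr p) * indicator {t..1} x \<le> c k"
      using x by (auto simp: c_def indicator_def ennreal_leI)
  qed (use t in auto)
  then have "ennreal ?L * ?I \<le> (\<Sum>k. ennreal ?L * (c k * ennreal (dy k - dy (Suc k))))"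
    by (simp add: mult_left_mono)
  also have "\<dots> \<le> ?S"
  proof (intro suminf_le)
    fix k
    show "ennreal ?L * (c k * ennreal (dy k - dy (Suc k)))
        \<le> ennreal (wt \<alpha> (dy k) * rearr \<Omega> f (dy (Suc k)) powr p)"
    proof (cases "t \<le> dy k")
      case True
      have "?L * (dy k - dy (Suc k)) \<le> (1 - ln (dy k)) powr (- \<alpha>) * dy k"
        using t True assms dy_unit by (intro mult_mono log_weight_mono) auto
      then have "?L * (dy k - dy (Suc k)) * rearr \<Omega> f (dy (Suc k)) powr p
          \<le> wt \<alpha> (dy k) * rearr \<Omega> f (dy (Suc k)) powr p"
        by (intro mult_right_mono) (auto simp: wt_def mult.commute)
      then show ?thesis
        using True by (simp add: c_def ennreal_mult'[symmetric] ennreal_mult''[symmetric] ennreal_leI mult_ac)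
    qed (simp add: c_def)
  qed auto
  finally have le: "ennreal ?L * ?I \<le> ?S" .
  have "ennreal ((1 - ln t) powr (- \<alpha> / p)) = enn_powr (ennreal ?L) (1 / p)"
    by (simp add: enn_powr_ennreal powr_powr)
  then have "ennreal ((1 - ln t) powr (- \<alpha> / p)) * enn_powr ?I (1 / p) = enn_powr (ennreal ?L * ?I) (1 / p)"
    using \<open>0 < p\<close> by (simp add: enn_powr_mult)
  also have "\<dots> \<le> enn_powr ?S (1 / p)"
    using \<open>0 < p\<close> by (intro enn_powr_mono le) auto
  finally show "ennreal ((1 - ln t) powr (- \<alpha> / p)) * enn_powr ?I (1 / p) \<le> enn_powr ?S (1 / p)" .
qed

text \<open>The supremum is tested at the single point t = 2^(-n-2) and the integral restricted to
  [t, 2t], where the rearrangement is at least its value at 2t = 2^(-n-1).\<close>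

lemma grand_norm_ge:
  assumes f: "f \<in> meas_on \<Omega>" and "0 \<le> \<alpha>" "0 < p"
  shows "ennreal (wt \<alpha> (dy (n + 2)) powr (1 / p) * rearr \<Omega> f (dy (Suc n))) \<le> grand_norm \<Omega> p \<alpha> f"
proof -
  let ?t = "dy (n + 2)" and ?R = "rearr \<Omega> f (dy (Suc n))"
  have t: "0 < ?t" "2 * ?t = dy (Suc n)" "2 * ?t \<le> 1"
    using dy_unit[of "Suc n"] by auto
  have R: "0 \<le> ?R" using f dy_unit by (intro rearr_nonneg)
  have root: "(x powr p * y) powr (1 / p) = x * y powr (1 / p)" if "0 \<le> x" for x y
    using that \<open>0 < p\<close> by (simp add: powr_mult powr_powr)
  have "ennreal (?R powr p * ?t) = (\<integral>\<^sup>+\<sigma>. ennreal (?R powr p) * indicator {?t..2 * ?t} \<sigma> \<partial>lborel)"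
    using t(1) by (subst nn_integral_cmult_indicator) (auto simp: ennreal_mult''[symmetric])
  also have "\<dots> \<le> (\<integral>\<^sup>+\<sigma>\<in>{?t..1}. ennreal (rearr \<Omega> f \<sigma> powr p) \<partial>lborel)"
  proof (intro nn_integral_mono)
    fix x :: real
    show "ennreal (?R powr p) * indicator {?t..2 * ?t} x \<le> ennreal (rearr \<Omega> f x powr p) * indicator {?t..1} x"
    proof (cases "x \<in> {?t..2 * ?t}")
      case True
      then have "?R powr p \<le> rearr \<Omega> f x powr p"
        using t(2) \<open>0 < p\<close> R f less_le_trans[OF t(1), of x] by (intro powr_mono2 rearr_antimono) auto
      then show ?thesis using True t by (auto simp: indicator_def ennreal_leI)
    qed auto
  qed
  finally have "enn_powr (ennreal (?R powr p * ?t)) (1 / p)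
      \<le> enn_powr (\<integral>\<^sup>+\<sigma>\<in>{?t..1}. ennreal (rearr \<Omega> f \<sigma> powr p) \<partial>lborel) (1 / p)"
    using \<open>0 < p\<close> by (intro enn_powr_mono) auto
  then have le: "ennreal (?R * ?t powr (1 / p))
      \<le> enn_powr (\<integral>\<^sup>+\<sigma>\<in>{?t..1}. ennreal (rearr \<Omega> f \<sigma> powr p) \<partial>lborel) (1 / p)"
    by (subst (asm) enn_powr_ennreal) (use t(1) root[OF R] in \<open>simp_all only: mult_nonneg_nonneg powr_ge_zero less_imp_le\<close>)
  have "ennreal (wt \<alpha> ?t powr (1 / p) * ?R)
      = ennreal ((1 - ln ?t) powr (- \<alpha> / p)) * ennreal (?R * ?t powr (1 / p))"
    using R by (subst wt_powr) (auto simp: power_le_one ennreal_mult'[symmetric] mult_ac simp del: power_Suc)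
  also have "\<dots> \<le> ennreal ((1 - ln ?t) powr (- \<alpha> / p)) *
      enn_powr (\<integral>\<^sup>+\<sigma>\<in>{?t..1}. ennreal (rearr \<Omega> f \<sigma> powr p) \<partial>lborel) (1 / p)"
    by (intro mult_left_mono le) auto
  also have "\<dots> \<le> grand_norm \<Omega> p \<alpha> f"
    unfolding grand_norm_def using t by (intro SUP_upper) auto
  finally show ?thesis .
qed

text \<open>This identity motivates \<open>wt\<close>: one weight serves every exponent
  \<open>a\<close>, because the logarithmic exponent -\<alpha> / a scales with 1 / a.\<close>

lemma LZ_integrand:
  assumes "0 < t" "t \<le> 1"
  shows "t powr (1 / a) * (1 - ln t) powr (- \<alpha> / a) * rearr \<Omega> f t = wt \<alpha> t powr (1 / a) * rearr \<Omega> f t"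
  using assms by (simp add: wt_powr)

text \<open>Each factor is replaced by its value at the end of the step where it is larger. A step
  has length \<open>dy (Suc k)\<close>, which cancels the factor 1 / t exactly.\<close>

lemma LZ_integral_le:
  assumes f: "f \<in> meas_on \<Omega>" and "0 \<le> \<alpha>" "0 < a" "0 < r"
  shows "(\<integral>\<^sup>+t\<in>{0<..<1}. ennreal ((t powr (1 / a) * (1 - ln t) powr (- \<alpha> / a) * rearr \<Omega> f t) powr r / t) \<partial>lborel)
    \<le> (\<Sum>k. ennreal ((wt \<alpha> (dy k) powr (1 / a) * rearr \<Omega> f (dy (Suc k))) powr r))"
proof -
  let ?b = "\<lambda>k. (wt \<alpha> (dy k) powr (1 / a) * rearr \<Omega> f (dy (Suc k))) powr r"
  have "(\<integral>\<^sup>+t\<in>{0<..<1}. ennreal ((t powr (1 / a) * (1 - ln t) powr (- \<alpha> / a) * rearr \<Omega> f t) powr r / t) \<partial>lborel)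
      \<le> (\<Sum>k. ennreal (?b k / dy (Suc k)) * ennreal (dy k - dy (Suc k)))"
  proof (rule nn_integral_le_steps[OF _ decseq_dy dy_tendsto])
    fix k x assume x: "dy (Suc k) < x" "x \<le> dy k"
    then have x01: "0 < x" "x \<le> 1" using dy_unit[of "Suc k"] dy_unit[of k] by linarith+
    have "(wt \<alpha> x powr (1 / a) * rearr \<Omega> f x) powr r / x \<le> ?b k / dy (Suc k)"
      using x x01 assms dy_unit[of "Suc k"] wt_pos[OF x01] dy_unit(2)[of k]
      by (intro frac_le powr_mono2 mult_mono rearr_antimono wt_mono mult_nonneg_nonneg rearr_nonneg) 
        (auto intro: less_imp_le)
    then show "ennreal ((x powr (1 / a) * (1 - ln x) powr (- \<alpha> / a) * rearr \<Omega> f x) powr r / x) * indicator {0<..<1} x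
        \<le> ennreal (?b k / dy (Suc k))"
      unfolding LZ_integrand[OF x01] by (auto simp: indicator_def ennreal_leI)
  qed auto
  also have "\<dots> = (\<Sum>k. ennreal (?b k))"
    by (simp add: ennreal_mult''[symmetric])
  finally show ?thesis .
qed

text \<open>The lower step sum takes weight and rearrangement at the opposite ends, so after a shift
  by one it pairs \<open>dy (k + 2)\<close> with \<open>dy (Suc k)\<close>. Returning to the weight
  at \<open>dy k\<close> costs 2^(2 (1 + \<alpha>)) before the powers 1 / a and r are applied; the
  outer 2 is the ratio of \<open>dy k\<close> to the step length.\<close>

lemma LZ_integral_ge:
  assumes f: "f \<in> meas_on \<Omega>" and "0 \<le> \<alpha>" "0 < a" "0 < r"
  shows "(\<Sum>k. ennreal ((wt \<alpha> (dy k) powr (1 / a) * rearr \<Omega> f (dy (Suc k))) powr r))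
    \<le> ennreal (2 * 2 powr (2 * (1 + \<alpha>) * r / a)) *
      (\<integral>\<^sup>+t\<in>{0<..<1}. ennreal ((t powr (1 / a) * (1 - ln t) powr (- \<alpha> / a) * rearr \<Omega> f t) powr r / t) \<partial>lborel)"
    (is "_ \<le> ennreal ?C * ?I")
proof -
  let ?b = "\<lambda>k. (wt \<alpha> (dy k) powr (1 / a) * rearr \<Omega> f (dy (Suc k))) powr r"
  define g where "g k = ennreal ((wt \<alpha> (dy (Suc k)) powr (1 / a) * rearr \<Omega> f (dy k)) powr r / dy k)
      * ennreal (dy k - dy (Suc k))" for k
  have steps: "(\<Sum>k. g k) \<le> ?I"
    unfolding g_def
  proof (rule steps_le_nn_integral[OF decseq_dy])
    fix k x assume x: "dy (Suc k) < x" "x < dy k"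
    then have x01: "0 < x" "x < 1" using dy_unit[of "Suc k"] dy_unit[of k] by linarith+
    have "(wt \<alpha> (dy (Suc k)) powr (1 / a) * rearr \<Omega> f (dy k)) powr r / dy k
        \<le> (wt \<alpha> x powr (1 / a) * rearr \<Omega> f x) powr r / x"
      using x x01 assms dy_unit[of "Suc k"] wt_dy_pos[of \<alpha> "Suc k"] dy_unit[of k]
      by (intro frac_le powr_mono2 mult_mono rearr_antimono wt_mono mult_nonneg_nonneg rearr_nonneg) 
        (auto intro: less_imp_le)
    then show "ennreal ((wt \<alpha> (dy (Suc k)) powr (1 / a) * rearr \<Omega> f (dy k)) powr r / dy k)
        \<le> ennreal ((x powr (1 / a) * (1 - ln x) powr (- \<alpha> / a) * rearr \<Omega> f x) powr r / x) * indicator {0<..<1} x"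
      unfolding LZ_integrand[OF x01(1) less_imp_le[OF x01(2)]] using x01 by (simp add: ennreal_leI)
  qed
  have "ennreal (?b k) \<le> ennreal ?C * g (Suc k)" for k
  proof -
    let ?R = "rearr \<Omega> f (dy (Suc k))"
    have R: "0 \<le> ?R" using f dy_unit by (intro rearr_nonneg)
    have "wt \<alpha> (dy k) \<le> 2 powr (2 * (1 + \<alpha>)) * wt \<alpha> (dy (k + 2))"
      using wt_dy_add_ge[OF \<open>0 \<le> \<alpha>\<close>, of k 2] by simp
    then have "?b k \<le> ((2 powr (2 * (1 + \<alpha>)) * wt \<alpha> (dy (k + 2))) powr (1 / a) * ?R) powr r"
      using assms R wt_dy_pos[of \<alpha> k]
      by (intro powr_mono2 mult_right_mono mult_nonneg_nonneg) (auto intro: less_imp_le)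
    also have "\<dots> = 2 powr (2 * (1 + \<alpha>) * r / a) * (wt \<alpha> (dy (k + 2)) powr (1 / a) * ?R) powr r"
      using R wt_dy_pos[of \<alpha> "k + 2"] by (simp add: powr_mult powr_powr del: power_Suc)
    finally have "ennreal (?b k) \<le> ennreal (2 powr (2 * (1 + \<alpha>) * r / a) * (wt \<alpha> (dy (k + 2)) powr (1 / a) * ?R) powr r)"
      by (rule ennreal_leI)
    also have "\<dots> = ennreal ?C * g (Suc k)"
      by (simp add: g_def ennreal_mult''[symmetric] ennreal_mult'[symmetric])
    finally show ?thesis .
  qed
  then have "(\<Sum>k. ennreal (?b k)) \<le> (\<Sum>k. ennreal ?C * g (Suc k))"
    by (intro suminf_le) auto
  also have "\<dots> \<le> ennreal ?C * (\<Sum>k. g k)"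
    using suminf_offset[of g 1] by (simp add: mult_left_mono)
  also have "\<dots> \<le> ennreal ?C * ?I"
    by (intro mult_left_mono steps) auto
  finally show ?thesis .
qed

end

section \<open>The K-functional\<close>

locale grand_couple = unit_domain \<Omega> for \<Omega> :: "'a::euclidean_space set" +
  fixes \<theta> r \<alpha> p q p\<theta> :: real
  assumes \<theta>: "0 < \<theta>" "\<theta> < 1" and r: "0 < r" and \<alpha>: "0 \<le> \<alpha>" and pq: "0 < p" "p < q"
    and p\<theta>: "1 / p\<theta> = (1 - \<theta>) / p + \<theta> / q"
begin

abbreviation "Kf \<equiv> Kfun \<Omega> (grand_space \<Omega> p \<alpha>) (grand_norm \<Omega> p \<alpha>) (grand_space \<Omega> q \<alpha>) (grand_norm \<Omega> q \<alpha>)"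

abbreviation "w k \<equiv> wt \<alpha> (dy k)"

definition "\<kappa> = 1 / p - 1 / q"

text \<open>The parameter is chosen so that w^(1/p) = \<rho> w^(1/q): the two terms of the
  K-functional then carry the same weight in their weak bounds.\<close>

definition "\<rho> k = w k powr \<kappa>"

text \<open>Common discretization: the sum of the r-th powers of \<open>b f\<close> is comparable
  with the r-th power of either norm. The weight and the rearrangement sit at the ends used in
  \<open>LZ_integral_le\<close>.\<close>

definition "b f k = w k powr (1 / p\<theta>) * rearr \<Omega> f (dy (Suc k))"

definition "interp_integral g =
  (\<integral>\<^sup>+\<tau>\<in>{0<..<1}. enn_powr (ennreal (\<tau> powr (- \<theta>)) * Kf g \<tau>) r * ennreal (1 / \<tau>) \<partial>lborel)"

lemma p\<theta>_pos: "0 < p\<theta>"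
proof -
  have "0 < (1 - \<theta>) / p + \<theta> / q"
    using \<theta> pq by (intro add_pos_pos divide_pos_pos) auto
  then show ?thesis using p\<theta> by (metis zero_less_divide_1_iff)
qed

lemma \<kappa>_pos: "0 < \<kappa>"
  using pq by (simp add: \<kappa>_def frac_less2)

text \<open>For the weights this means w^(1/p\<theta>) = \<rho>^(-\<theta>) w^(1/p) =
  \<rho>^(1-\<theta>) w^(1/q). The first form suits the part measured in the \<open>p\<close>-norm,
  the second the part measured in the \<open>q\<close>-norm.\<close>

lemma exponent_split: "1 / p - \<theta> * \<kappa> = 1 / p\<theta>" "1 / q + (1 - \<theta>) * \<kappa> = 1 / p\<theta>"
  unfolding p\<theta> \<kappa>_def by (simp_all add: field_simps add_divide_distrib diff_divide_distrib)

lemma w_pos: "0 < w k" by (rule wt_dy_pos)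

lemma \<rho>_pos: "0 < \<rho> k"
  using w_pos[of k] by (simp add: \<rho>_def)

lemma \<rho>_0: "\<rho> 0 = 1"
  by (simp add: \<rho>_def wt_one)

lemma decseq_\<rho>: "decseq \<rho>"
  unfolding decseq_def \<rho>_def using decseqD[OF decseq_wt_dy[OF \<alpha>]] \<kappa>_pos w_pos
  by (intro allI impI powr_mono2) (auto intro: less_imp_le)

lemma \<rho>_le_1: "\<rho> k \<le> 1"
  using decseqD[OF decseq_\<rho>, of 0 k] by (simp add: \<rho>_0)

lemma \<rho>_tendsto: "\<rho> \<longlonglongrightarrow> 0"
  unfolding \<rho>_def using \<kappa>_pos wt_dy_tendsto[OF \<alpha>] w_pos
  by (intro tendsto_zero_powrI[where b = \<kappa>]) (auto intro!: always_eventually less_imp_le)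

lemma \<rho>_add_le: "\<rho> (k + j) \<le> (2 powr (- \<kappa>)) powr real j * \<rho> k"
proof -
  have "\<rho> (k + j) \<le> (dy j * w k) powr \<kappa>"
    unfolding \<rho>_def using \<kappa>_pos w_pos[of "k + j"]
    by (intro powr_mono2 wt_dy_add_le \<alpha>) auto
  also have "\<dots> = dy j powr \<kappa> * \<rho> k"
    by (simp add: powr_mult \<rho>_def)
  also have "dy j = 2 powr (- real j)"
    by (simp add: powr_minus powr_realpow power_one_over inverse_eq_divide)
  finally show ?thesis by (simp add: powr_powr mult.commute)
qed

lemma \<rho>_Suc_le: "\<rho> (Suc k) \<le> 2 powr (- \<kappa>) * \<rho> k"
  using \<rho>_add_le[of k 1] by simp

lemma \<rho>_Suc_ge: "\<rho> k \<le> 2 powr (\<kappa> * (1 + \<alpha>)) * \<rho> (Suc k)"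
proof -
  have "\<rho> k \<le> (2 powr (1 + \<alpha>) * w (Suc k)) powr \<kappa>"
    unfolding \<rho>_def using w_pos[of k] \<kappa>_pos
    by (intro powr_mono2 wt_dy_Suc_ge \<alpha>) auto
  then show ?thesis
    by (simp only: powr_mult powr_powr \<rho>_def mult.commute)
qed

lemma \<rho>_powr: "\<rho> k powr a = w k powr (\<kappa> * a)"
  by (simp add: \<rho>_def powr_powr)

lemma b_nonneg: "f \<in> meas_on \<Omega> \<Longrightarrow> 0 \<le> b f k"
  unfolding b_def by (intro mult_nonneg_nonneg rearr_nonneg dy_unit) auto

text \<open>If one of the norms is infinite, the pair is not admissible in the infimum, but then the
  right-hand side is infinite.\<close>

lemma Kfun_le:
  assumes "g0 \<in> meas_on \<Omega>" "g1 \<in> meas_on \<Omega>" "\<And>x. x \<in> \<Omega> \<Longrightarrow> g x = g0 x + g1 x" "0 < t"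
  shows "Kf g t \<le> grand_norm \<Omega> p \<alpha> g0 + ennreal t * grand_norm \<Omega> q \<alpha> g1"
proof (cases "grand_norm \<Omega> p \<alpha> g0 < top \<and> grand_norm \<Omega> q \<alpha> g1 < top")
  case True
  then show ?thesis
    using assms unfolding Kfun_def by (intro INF_lower2[of "(g0, g1)"]) (auto simp: grand_space_def)
next
  case False
  then have "grand_norm \<Omega> p \<alpha> g0 = top \<or> ennreal t * grand_norm \<Omega> q \<alpha> g1 = top"
    using \<open>0 < t\<close> by (auto simp: less_top[symmetric] ennreal_mult_top)
  then have "grand_norm \<Omega> p \<alpha> g0 + ennreal t * grand_norm \<Omega> q \<alpha> g1 = top"
    by (auto simp del: ennreal_mult_eq_top_iff)
  then show ?thesis by (metis top_greatest)
qed

section \<open>Lower estimate of the interpolation integral\<close>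

lemma Kfun_mono: "s \<le> t \<Longrightarrow> Kf g s \<le> Kf g t"
  unfolding Kfun_def by (intro INF_mono' add_left_mono mult_right_mono ennreal_leI) auto

lemma Kfun_ge: "ennreal (w (n + 2) powr (1 / p) * rearr \<Omega> g (dy n)) \<le> Kf g (\<rho> n)"
  unfolding Kfun_def
proof (rule INF_greatest)
  fix gg assume "gg \<in> {(g0, g1). g0 \<in> grand_space \<Omega> p \<alpha> \<and> g1 \<in> grand_space \<Omega> q \<alpha> \<and> (\<forall>x\<in>\<Omega>. g x = g0 x + g1 x)}"
  then obtain g0 g1 where gg: "gg = (g0, g1)" and m: "g0 \<in> meas_on \<Omega>" "g1 \<in> meas_on \<Omega>"
    and g: "\<And>x. x \<in> \<Omega> \<Longrightarrow> g x = g0 x + g1 x"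
    by (auto simp: grand_space_def)
  let ?R0 = "rearr \<Omega> g0 (dy (Suc n))" and ?R1 = "rearr \<Omega> g1 (dy (Suc n))" and ?w = "w (n + 2)"
  have R: "0 \<le> ?R0" "0 \<le> ?R1" using m dy_unit by (auto intro: rearr_nonneg simp del: power_Suc)
  \<comment> \<open>Halving the argument moves the rearrangements to the index \<open>Suc n\<close>,
    for which \<open>grand_norm_ge\<close> provides the weight of index
    \<open>n + 2\<close>.\<close>
  have "rearr \<Omega> g (dy n) \<le> ?R0 + ?R1"
    using rearr_add[OF m dy_unit(1) dy_unit(1) g, of "Suc n" "Suc n"] by simp
  then have "?w powr (1 / p) * rearr \<Omega> g (dy n) \<le> ?w powr (1 / p) * ?R0 + ?w powr (1 / p) * ?R1"
    by (metis distrib_left mult_left_mono powr_ge_zero)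
  also have "?w powr (1 / p) = ?w powr \<kappa> * ?w powr (1 / q)"
    by (simp add: \<kappa>_def powr_add[symmetric])
  \<comment> \<open>The \<kappa>-th power of the weight at \<open>n + 2\<close> is
    \<open>\<rho> (n + 2)\<close>, hence at most \<open>\<rho> n\<close>, the factor in front of the
    \<open>q\<close>-norm.\<close>
  also have "?w powr \<kappa> * ?w powr (1 / q) * ?R1 \<le> \<rho> n * (?w powr (1 / q) * ?R1)"
    using decseqD[OF decseq_\<rho>, of n "n + 2"] R
    by (simp add: \<rho>_def mult.assoc mult_right_mono)
  finally have "?w powr (1 / p) * rearr \<Omega> g (dy n) \<le> ?w powr (1 / p) * ?R0 + \<rho> n * (?w powr (1 / q) * ?R1)"
    by (simp add: \<kappa>_def powr_add[symmetric])
  then have "ennreal (?w powr (1 / p) * rearr \<Omega> g (dy n))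
      \<le> ennreal (?w powr (1 / p) * ?R0) + ennreal (\<rho> n) * ennreal (?w powr (1 / q) * ?R1)"
    using R \<rho>_pos[of n] by (simp add: ennreal_mult'[symmetric] ennreal_plus[symmetric] ennreal_leI del: ennreal_plus power_Suc)
  also have "\<dots> \<le> grand_norm \<Omega> p \<alpha> g0 + ennreal (\<rho> n) * grand_norm \<Omega> q \<alpha> g1"
    using pq by (intro add_mono mult_left_mono grand_norm_ge m \<alpha>) auto
  finally show "ennreal (?w powr (1 / p) * rearr \<Omega> g (dy n))
      \<le> grand_norm \<Omega> p \<alpha> (fst gg) + ennreal (\<rho> n) * grand_norm \<Omega> q \<alpha> (snd gg)"
    by (simp add: gg)
qed

text \<open>On the step from \<open>\<rho> (Suc k)\<close> to \<open>\<rho> k\<close> the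
  K-functional is at least its value at the left end, where \<open>Kfun_ge\<close> supplies the
  weight of index k + 3; returning to index k costs 2^(3 (1 + \<alpha>) r / p). The relative length
  of the step is at least 1 - 2^(-\<kappa>), because \<open>\<rho>\<close> decays at least
  geometrically.\<close>

lemma interp_integral_ge:
  assumes f: "f \<in> meas_on \<Omega>"
  shows "(\<Sum>k. ennreal (b f k powr r))
    \<le> ennreal (2 powr (3 * (1 + \<alpha>) * r / p) / (1 - 2 powr (- \<kappa>))) * interp_integral f"
    (is "_ \<le> ennreal ?C * _")
proof -
  define h where "h k = (\<rho> k powr (- \<theta>) * (w (k + 3) powr (1 / p) * rearr \<Omega> f (dy (Suc k)))) powr r" for k
  have R: "0 \<le> rearr \<Omega> f (dy (Suc k))" for k
    by (intro rearr_nonneg f dy_unit)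
  have "(\<Sum>k. ennreal (h k / \<rho> k) * ennreal (\<rho> k - \<rho> (Suc k))) \<le> interp_integral f"
    unfolding interp_integral_def
  proof (rule steps_le_nn_integral[OF decseq_\<rho>])
    fix k x assume x: "\<rho> (Suc k) < x" "x < \<rho> k"
    then have x01: "0 < x" "x < 1" using \<rho>_pos[of "Suc k"] \<rho>_le_1[of k] by linarith+
    have "ennreal (w (k + 3) powr (1 / p) * rearr \<Omega> f (dy (Suc k))) \<le> Kf f x"
      using Kfun_ge[of "Suc k" f] Kfun_mono[of "\<rho> (Suc k)" x f] x
      by (simp add: numeral_3_eq_3 order_trans del: power_Suc)
    moreover have "\<rho> k powr (- \<theta>) \<le> x powr (- \<theta>)"
      using x x01 \<theta> by (intro powr_mono2') auto
    ultimately have "ennreal (\<rho> k powr (- \<theta>)) * ennreal (w (k + 3) powr (1 / p) * rearr \<Omega> f (dy (Suc k)))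
        \<le> ennreal (x powr (- \<theta>)) * Kf f x"
      by (intro mult_mono ennreal_leI) auto
    then have "enn_powr (ennreal (\<rho> k powr (- \<theta>) * (w (k + 3) powr (1 / p) * rearr \<Omega> f (dy (Suc k))))) r
        \<le> enn_powr (ennreal (x powr (- \<theta>)) * Kf f x) r"
      using r by (intro enn_powr_mono) (auto simp: ennreal_mult')
    then have "ennreal (h k) \<le> enn_powr (ennreal (x powr (- \<theta>)) * Kf f x) r"
      using R[of k] by (subst (asm) enn_powr_ennreal) (auto simp: h_def)
    moreover have "1 / \<rho> k \<le> 1 / x" using x x01 by (simp add: frac_le)
    ultimately have "ennreal (h k) * ennreal (1 / \<rho> k)
        \<le> enn_powr (ennreal (x powr (- \<theta>)) * Kf f x) r * ennreal (1 / x)"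
      by (intro mult_mono ennreal_leI) auto
    then show "ennreal (h k / \<rho> k) \<le> enn_powr (ennreal (x powr (- \<theta>)) * Kf f x) r * ennreal (1 / x) * indicator {0<..<1} x"
      using x01 \<rho>_pos[of k] by (simp add: ennreal_mult''[symmetric])
  qed
  moreover have "ennreal (b f k powr r) \<le> ennreal ?C * (ennreal (h k / \<rho> k) * ennreal (\<rho> k - \<rho> (Suc k)))" for k
  proof -
    let ?R = "rearr \<Omega> f (dy (Suc k))" and ?A = "2 powr (3 * (1 + \<alpha>))"
    have "w k \<le> ?A * w (k + 3)"
      using wt_dy_add_ge[OF \<alpha>, of k 3] by simp
    then have "w k powr (1 / p) \<le> (?A * w (k + 3)) powr (1 / p)"
      using w_pos[of k] pq by (intro powr_mono2) (auto intro: less_imp_le)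
    then have "\<rho> k powr (- \<theta>) * w k powr (1 / p) * ?R \<le> \<rho> k powr (- \<theta>) * (?A * w (k + 3)) powr (1 / p) * ?R"
      using R by (intro mult_right_mono mult_left_mono) auto
    moreover have "b f k = \<rho> k powr (- \<theta>) * w k powr (1 / p) * ?R"
      by (simp add: b_def \<rho>_powr powr_add[symmetric] exponent_split(1)[symmetric] algebra_simps)
    ultimately have "b f k powr r \<le> (\<rho> k powr (- \<theta>) * (?A * w (k + 3)) powr (1 / p) * ?R) powr r"
      using r b_nonneg[OF f, of k] by (intro powr_mono2) (auto simp del: power_Suc)
    also have "\<dots> = 2 powr (3 * (1 + \<alpha>) * r / p) * h k"
      using R[of k] w_pos[of "k + 3"] by (simp add: h_def powr_mult powr_powr mult_ac del: power_Suc)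
    also have "\<dots> \<le> ?C * (h k / \<rho> k * (\<rho> k - \<rho> (Suc k)))"
    proof -
      have "1 - 2 powr (- \<kappa>) > 0" using \<kappa>_pos powr_less_mono[of "- \<kappa>" 0 2] by simp
      moreover have "1 - 2 powr (- \<kappa>) \<le> (\<rho> k - \<rho> (Suc k)) / \<rho> k"
        using \<rho>_Suc_le[of k] \<rho>_pos[of k] by (simp add: field_simps)
      ultimately have "1 \<le> (\<rho> k - \<rho> (Suc k)) / \<rho> k / (1 - 2 powr (- \<kappa>))"
        by (simp only: le_divide_eq_1_pos)
      then have "2 powr (3 * (1 + \<alpha>) * r / p) * h k * 1
          \<le> 2 powr (3 * (1 + \<alpha>) * r / p) * h k * ((\<rho> k - \<rho> (Suc k)) / \<rho> k / (1 - 2 powr (- \<kappa>)))"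
        by (intro mult_left_mono) (auto simp: h_def)
      then show ?thesis by (simp add: mult_ac)
    qed
    finally have "ennreal (b f k powr r) \<le> ennreal (?C * (h k / \<rho> k * (\<rho> k - \<rho> (Suc k))))"
      by (rule ennreal_leI)
    also have "\<dots> = ennreal ?C * (ennreal (h k / \<rho> k) * ennreal (\<rho> k - \<rho> (Suc k)))"
      using \<rho>_pos[of k] decseqD[OF decseq_\<rho>, of k "Suc k"]
      by (subst ennreal_mult'', simp add: h_def, subst ennreal_mult'', simp_all)
    finally show ?thesis .
  qed
  then have "(\<Sum>k. ennreal (b f k powr r)) \<le> (\<Sum>k. ennreal ?C * (ennreal (h k / \<rho> k) * ennreal (\<rho> k - \<rho> (Suc k))))"
    by (intro suminf_le) auto
  ultimately show ?thesis
    by (simp add: mult_left_mono order_trans)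
qed

section \<open>Geometric kernels and the upper estimate of the interpolation integral\<close>

lemma ratio_below:
  assumes "n \<le> k"
  shows "\<rho> n powr (- \<theta>) * w k powr (1 / p) \<le> (2 powr (- \<kappa> * \<theta>)) powr real (ndist k n) * w k powr (1 / p\<theta>)"
proof -
  \<comment> \<open>The quotient of the weights is the \<theta>-th power of
    \<open>\<rho> k / \<rho> n\<close>, and \<open>\<rho>\<close> loses at least the factor
    2^\<kappa> per index.\<close>
  have "\<rho> k powr \<theta> \<le> ((2 powr (- \<kappa>)) powr real (k - n) * \<rho> n) powr \<theta>"
    using \<rho>_add_le[of n "k - n"] \<rho>_pos[of k] \<theta> assms by (intro powr_mono2) auto
  also have "\<dots> = (2 powr (- \<kappa> * \<theta>)) powr real (ndist k n) * \<rho> n powr \<theta>"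
    using assms by (simp add: ndist_def powr_mult powr_powr mult_ac)
  finally have "\<rho> n powr (- \<theta>) * \<rho> k powr \<theta> \<le> (2 powr (- \<kappa> * \<theta>)) powr real (ndist k n)"
    using \<rho>_pos[of n] by (simp add: powr_minus field_simps)
  then have "\<rho> n powr (- \<theta>) * \<rho> k powr \<theta> * w k powr (1 / p\<theta>)
      \<le> (2 powr (- \<kappa> * \<theta>)) powr real (ndist k n) * w k powr (1 / p\<theta>)"
    by (rule mult_right_mono) simp
  moreover have "w k powr (1 / p) = \<rho> k powr \<theta> * w k powr (1 / p\<theta>)"
    by (simp add: \<rho>_powr powr_add[symmetric] exponent_split(1)[symmetric] algebra_simps)
  ultimately show ?thesis by (simp add: mult.assoc)
qed

text \<open>Mirror image of \<open>ratio_below\<close>: the excess is now the power 1 - \<theta> of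
  \<open>\<rho> n / \<rho> k\<close>. Since \<theta> lies strictly between 0 and 1, both kernels
  decay.\<close>

lemma ratio_above:
  assumes "k \<le> n"
  shows "\<rho> n powr (1 - \<theta>) * w k powr (1 / q)
    \<le> (2 powr (- \<kappa> * (1 - \<theta>))) powr real (ndist k n) * w k powr (1 / p\<theta>)"
proof -
  have "\<rho> n powr (1 - \<theta>) \<le> ((2 powr (- \<kappa>)) powr real (n - k) * \<rho> k) powr (1 - \<theta>)"
    using \<rho>_add_le[of k "n - k"] \<rho>_pos[of n] \<theta> assms by (intro powr_mono2) auto
  also have "\<dots> = (2 powr (- \<kappa> * (1 - \<theta>))) powr real (ndist k n) * \<rho> k powr (1 - \<theta>)"
    using assms by (simp add: ndist_def powr_mult powr_powr mult_ac)
  finally have "\<rho> n powr (1 - \<theta>) * w k powr (1 / q)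
      \<le> (2 powr (- \<kappa> * (1 - \<theta>))) powr real (ndist k n) * \<rho> k powr (1 - \<theta>) * w k powr (1 / q)"
    by (rule mult_right_mono) simp
  moreover have "w k powr (1 / p\<theta>) = \<rho> k powr (1 - \<theta>) * w k powr (1 / q)"
    by (simp add: \<rho>_powr powr_add[symmetric] exponent_split(2)[symmetric] algebra_simps)
  ultimately show ?thesis by (simp add: mult.assoc)
qed

text \<open>The scalar is absorbed into the summands, so that both parts of the truncation can be
  estimated term by term.\<close>

lemma weighted_grand_norm_le:
  assumes f: "f \<in> meas_on \<Omega>" and "0 < s" "0 \<le> c"
    and S: "(\<Sum>k. ennreal ((c * w k powr (1 / s) * rearr \<Omega> f (dy (Suc k))) powr s)) \<le> S"
  shows "ennreal c * grand_norm \<Omega> s \<alpha> f \<le> enn_powr S (1 / s)"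
proof -
  have "ennreal c * grand_norm \<Omega> s \<alpha> f
      \<le> ennreal c * enn_powr (\<Sum>k. ennreal (w k * rearr \<Omega> f (dy (Suc k)) powr s)) (1 / s)"
    by (intro mult_left_mono grand_norm_le f \<alpha> \<open>0 < s\<close>) auto
  also have "\<dots> = enn_powr (\<Sum>k. ennreal (c powr s) * ennreal (w k * rearr \<Omega> f (dy (Suc k)) powr s)) (1 / s)"
    using \<open>0 < s\<close> \<open>0 \<le> c\<close> by (simp add: cmult_enn_powr_inverse)
  also have "(\<lambda>k. ennreal (c powr s) * ennreal (w k * rearr \<Omega> f (dy (Suc k)) powr s))
      = (\<lambda>k. ennreal ((c * w k powr (1 / s) * rearr \<Omega> f (dy (Suc k))) powr s))"
    using \<open>0 < s\<close> w_pos
    by (simp add: fun_eq_iff ennreal_mult'[symmetric] powr_mult powr_powr less_imp_le mult_ac)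
  also have "enn_powr (suminf \<dots>) (1 / s) \<le> enn_powr S (1 / s)"
    using \<open>0 < s\<close> by (intro enn_powr_mono S) auto
  finally show ?thesis .
qed

text \<open>For k < n the rearrangement of the upper part vanishes at \<open>dy (Suc k)\<close>,
  which is at least \<open>dy n\<close>; for k >= n it is at most that of \<open>f\<close>, and
  \<open>ratio_below\<close> provides the kernel.\<close>

lemma high_part_le:
  assumes f: "f \<in> meas_on \<Omega>"
  shows "ennreal (\<rho> n powr (- \<theta>)) * grand_norm \<Omega> p \<alpha> (trunc_high f (dy n))
    \<le> enn_powr (\<Sum>k. ennreal (((2 powr (- \<kappa> * \<theta>)) powr real (ndist k n) * b f k) powr p)) (1 / p)"
proof (intro weighted_grand_norm_le suminf_le ennreal_leI powr_mono2)
  fix k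
  let ?R = "rearr \<Omega> (trunc_high f (dy n)) (dy (Suc k))" and ?F = "rearr \<Omega> f (dy (Suc k))"
  have R: "0 \<le> ?R" by (intro rearr_nonneg meas_on_trunc f dy_unit)
  show "0 \<le> \<rho> n powr (- \<theta>) * w k powr (1 / p) * ?R"
    using R by (intro mult_nonneg_nonneg) auto
  show "\<rho> n powr (- \<theta>) * w k powr (1 / p) * ?R \<le> (2 powr (- \<kappa> * \<theta>)) powr real (ndist k n) * b f k"
  proof (cases "n \<le> k")
    case True
    then have "\<rho> n powr (- \<theta>) * w k powr (1 / p) * ?R
        \<le> (2 powr (- \<kappa> * \<theta>)) powr real (ndist k n) * w k powr (1 / p\<theta>) * ?F"
      using R by (intro mult_mono ratio_below rearr_trunc_high_le f dy_unit) auto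
    then show ?thesis by (simp add: b_def mult.assoc)
  next
    case False
    then have "?R = 0"
      by (intro rearr_trunc_high_eq_0 f dy_unit power_decreasing) auto
    then show ?thesis using b_nonneg[OF f, of k] by (simp del: power_Suc)
  qed
qed (use pq f meas_on_trunc in auto)

text \<open>In the terms \<open>k \<ge> n\<close> the rearrangement of the truncation is at most its value at
  \<open>2\<^sup>-\<^sup>n\<close>, which occurs in \<open>b f (n - 1)\<close>; these terms are therefore dominated by a geometric
  series times the term \<open>n - 1\<close>, whence the constant \<open>5 = 1 + 4\<close>. For \<open>n = 0\<close> they vanish,
  because the rearrangement is zero at 1.\<close>

lemma low_part_le:
  assumes f: "f \<in> meas_on \<Omega>"
  shows "ennreal (\<rho> n powr (1 - \<theta>)) * grand_norm \<Omega> q \<alpha> (trunc_low f (dy n))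
    \<le> enn_powr (ennreal 5 * (\<Sum>k. ennreal (((2 powr (- \<kappa> * (1 - \<theta>))) powr real (ndist k n) * b f k) powr q))) (1 / q)"
proof (intro weighted_grand_norm_le)
  let ?y = "2 powr (- \<kappa> * (1 - \<theta>))"
  let ?R = "\<lambda>k. rearr \<Omega> (trunc_low f (dy n)) (dy (Suc k))"
  let ?u = "\<lambda>k. (\<rho> n powr (1 - \<theta>) * w k powr (1 / q) * ?R k) powr q"
  let ?v = "\<lambda>k. (?y powr real (ndist k n) * b f k) powr q"
  have q: "0 < q" using pq by simp
  have R: "0 \<le> ?R k" for k by (intro rearr_nonneg meas_on_trunc f dy_unit)
  have below: "?u k \<le> ?v k" if "k < n" for k
  proof -
    have "\<rho> n powr (1 - \<theta>) * w k powr (1 / q) * ?R k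
        \<le> ?y powr real (ndist k n) * w k powr (1 / p\<theta>) * rearr \<Omega> f (dy (Suc k))"
      using R that by (intro mult_mono ratio_above rearr_trunc_low_le f dy_unit) auto
    then show ?thesis
      using q R[of k] by (intro powr_mono2 mult_nonneg_nonneg) (auto simp: b_def mult.assoc simp del: power_Suc)
  qed
  show "(\<Sum>k. ennreal (?u k)) \<le> ennreal 5 * (\<Sum>k. ennreal (?v k))"
  proof (cases n)
    case 0
    have "?R k = 0" for k
      using R[of k] rearr_trunc_low_le(2)[OF f dy_unit(1) dy_unit(1), of n "Suc k"] 0 by (simp add: rearr_one)
    then show ?thesis by (simp del: power_Suc)
  next
    case (Suc m)
    have above: "?u k \<le> ?v m * (1 / 2) powr real (ndist k m)" if "n \<le> k" for k
    proof -
      have "w k \<le> dy (ndist k m) * w m"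
        using wt_dy_add_le[OF \<alpha>, of m "k - m"] that Suc by (simp add: ndist_def)
      then have "w k powr (1 / q) \<le> (dy (ndist k m) * w m) powr (1 / q)"
        using w_pos[of k] q by (intro powr_mono2) auto
      also have "\<dots> = w m powr (1 / q) * dy (ndist k m) powr (1 / q)"
        by (simp add: powr_mult)
      finally have "\<rho> n powr (1 - \<theta>) * w k powr (1 / q) * ?R k
          \<le> \<rho> n powr (1 - \<theta>) * (w m powr (1 / q) * dy (ndist k m) powr (1 / q)) * rearr \<Omega> f (dy n)"
        using R[of k] by (intro mult_mono rearr_trunc_low_le f dy_unit) auto
      also have "\<dots> = \<rho> n powr (1 - \<theta>) * w m powr (1 / q) * (rearr \<Omega> f (dy n) * dy (ndist k m) powr (1 / q))"
        by (simp only: mult_ac)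
      \<comment> \<open>\<open>ratio_above\<close> is applied to the neighbouring indices m = n - 1
        and n, and its kernel value is kept so that the whole term \<open>?v m\<close>
        appears.\<close>
      also have "\<dots> \<le> ?y powr real (ndist m n) * w m powr (1 / p\<theta>) * (rearr \<Omega> f (dy n) * dy (ndist k m) powr (1 / q))"
        using Suc by (intro mult_right_mono ratio_above mult_nonneg_nonneg rearr_nonneg f dy_unit) auto
      also have "\<dots> = ?y powr real (ndist m n) * b f m * dy (ndist k m) powr (1 / q)"
        by (simp only: b_def Suc mult_ac)
      finally have "?u k \<le> (?y powr real (ndist m n) * b f m * dy (ndist k m) powr (1 / q)) powr q"
        using q R[of k] by (intro powr_mono2 mult_nonneg_nonneg) auto
      also have "\<dots> = ?v m * (1 / 2) powr real (ndist k m)"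
        using q by (simp add: powr_mult powr_powr powr_realpow del: power_Suc)
      finally show ?thesis .
    qed
    have "ennreal (?u k) \<le> ennreal (?v k) + ennreal (?v m) * ennreal ((1 / 2) powr real (ndist k m))" for k
    proof -
      have "?u k \<le> ?v k + ?v m * (1 / 2) powr real (ndist k m)"
        using below[of k] above[of k] by (cases "k < n") (auto intro: add_increasing add_increasing2)
      then show ?thesis
        by (simp add: ennreal_mult''[symmetric] ennreal_plus[symmetric] ennreal_leI del: ennreal_plus power_Suc)
    qed
    then have "(\<Sum>k. ennreal (?u k))
        \<le> (\<Sum>k. ennreal (?v k) + ennreal (?v m) * ennreal ((1 / 2) powr real (ndist k m)))"
      by (intro suminf_le) auto
    also have "\<dots> = (\<Sum>k. ennreal (?v k)) + ennreal (?v m) * (\<Sum>k. ennreal ((1 / 2) powr real (ndist k m)))"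
      by (subst suminf_add[symmetric]) auto
    also have "\<dots> \<le> (\<Sum>k. ennreal (?v k)) + (\<Sum>k. ennreal (?v k)) * ennreal (2 / (1 - 1 / 2))"
      by (intro add_mono mult_mono suminf_geometric_ndist
          suminf_ennreal_term_le[where f = "\<lambda>k. ennreal (?v k)"]) auto
    also have "\<dots> = (\<Sum>k. ennreal (?v k)) * (1 + 4)"
      unfolding distrib_left by simp
    also have "\<dots> = ennreal 5 * (\<Sum>k. ennreal (?v k))"
      by (simp add: mult.commute)
    finally show ?thesis .
  qed
qed (use pq f meas_on_trunc in auto)

text \<open>The infimum is tested with the truncation at the height f_*(2^(-n)). The factor
  \<open>\<rho> n\<close> in front of the lower part turns the exponent -\<theta> into 1 -
  \<theta>.\<close>

lemma Kfun_dyadic_le: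
  assumes f: "f \<in> meas_on \<Omega>"
  shows "ennreal (\<rho> n powr (- \<theta>)) * Kf f (\<rho> n)
    \<le> enn_powr (\<Sum>k. ennreal (((2 powr (- \<kappa> * \<theta>)) powr real (ndist k n) * b f k) powr p)) (1 / p)
      + enn_powr (ennreal 5 * (\<Sum>k. ennreal (((2 powr (- \<kappa> * (1 - \<theta>))) powr real (ndist k n) * b f k) powr q))) (1 / q)"
proof -
  let ?N0 = "grand_norm \<Omega> p \<alpha> (trunc_high f (dy n))" and ?N1 = "grand_norm \<Omega> q \<alpha> (trunc_low f (dy n))"
  have "ennreal (\<rho> n powr (- \<theta>)) * Kf f (\<rho> n) \<le> ennreal (\<rho> n powr (- \<theta>)) * (?N0 + ennreal (\<rho> n) * ?N1)"
    by (intro mult_left_mono Kfun_le meas_on_trunc f \<rho>_pos) (auto simp: trunc_high_def)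
  also have "\<dots> = ennreal (\<rho> n powr (- \<theta>)) * ?N0 + ennreal (\<rho> n powr (- \<theta>) * \<rho> n) * ?N1"
    using \<rho>_pos[of n] by (simp add: distrib_left mult.assoc ennreal_mult'')
  also have "\<rho> n powr (- \<theta>) * \<rho> n = \<rho> n powr (1 - \<theta>)"
    using \<rho>_pos[of n] by (simp add: powr_diff powr_minus field_simps)
  finally show ?thesis
    using high_part_le[OF f, of n] low_part_le[OF f, of n] by (meson add_mono order_trans)
qed

text \<open>On each step between consecutive values of \<open>\<rho>\<close> the K-functional is at
  most its value at the right end. \<open>discrete_Hardy\<close> then removes the kernels, with
  ratio \<open>x\<close> and exponent \<open>p\<close> for the upper part, \<open>y\<close> and
  \<open>q\<close> for the lower. The constant is fixed before \<open>f\<close>, hence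
  uniform.\<close>

lemma interp_integral_le:
  obtains C where "0 < C" "\<And>f. f \<in> meas_on \<Omega> \<Longrightarrow> interp_integral f \<le> ennreal C * (\<Sum>k. ennreal (b f k powr r))"
proof -
  define M where "M = 2 powr (\<kappa> * (1 + \<alpha>))"
  define x where "x = 2 powr (- \<kappa> * \<theta>)"
  define y where "y = 2 powr (- \<kappa> * (1 - \<theta>))"
  define Hx where "Hx = (2 / (1 - x powr (p / 2))) powr (r / p) * (2 / (1 - x powr (r / 2)))"
  define Hy where "Hy = (2 / (1 - y powr (q / 2))) powr (r / q) * (2 / (1 - y powr (r / 2)))"
  \<comment> \<open>One \<open>M\<close> bounds the length of a step divided by its left end,
    \<open>M powr (\<theta> * r)\<close> the variation of \<tau>^(-\<theta>) after raising to the
    power r, and \<open>2 powr r\<close> separates the two parts of K.\<close>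
  define D where "D = M * M powr (\<theta> * r) * 2 powr r"
  have q: "0 < q" using pq by simp
  have M: "0 < M" by (simp add: M_def)
  have ratio: "\<rho> k \<le> M * \<rho> (Suc k)" for k
    unfolding M_def by (rule \<rho>_Suc_ge)
  have x: "0 < x" "x < 1" using powr_less_mono[of "- \<kappa> * \<theta>" 0 2] \<kappa>_pos \<theta> by (auto simp: x_def)
  have y: "0 < y" "y < 1" using powr_less_mono[of "- \<kappa> * (1 - \<theta>)" 0 2] \<kappa>_pos \<theta> by (auto simp: y_def)
  have pos: "0 < 1 - z powr (a / 2)" if "0 < z" "z < 1" "0 < a" for z a :: real
    using that powr_less_mono2[of "a / 2" z 1] by simp
  have H: "0 \<le> Hx" "0 \<le> Hy"
    using pos[OF x r] pos[OF y r] by (auto simp: Hx_def Hy_def zero_le_mult_iff zero_le_divide_iff)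
  have "interp_integral f \<le> ennreal (D * (Hx + 5 powr (r / q) * Hy + 1)) * (\<Sum>k. ennreal (b f k powr r))"
    if f: "f \<in> meas_on \<Omega>" for f
  proof -
    let ?B = "\<Sum>k. ennreal (b f k powr r)"
    let ?S = "\<lambda>n. \<Sum>k. ennreal ((x powr real (ndist k n) * b f k) powr p)"
    let ?T = "\<lambda>n. \<Sum>k. ennreal ((y powr real (ndist k n) * b f k) powr q)"
    let ?c = "\<lambda>k. enn_powr (ennreal (\<rho> (Suc k) powr (- \<theta>)) * Kf f (\<rho> k)) r * ennreal (1 / \<rho> (Suc k))"
    have "interp_integral f \<le> (\<Sum>k. ?c k * ennreal (\<rho> k - \<rho> (Suc k)))"
      unfolding interp_integral_def
    proof (rule nn_integral_le_steps[OF \<rho>_0 decseq_\<rho> \<rho>_tendsto])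
      fix k t assume t: "\<rho> (Suc k) < t" "t \<le> \<rho> k"
      have "enn_powr (ennreal (t powr (- \<theta>)) * Kf f t) r * ennreal (1 / t) \<le> ?c k"
        using t \<theta> r \<rho>_pos[of "Suc k"]
        by (intro mult_mono enn_powr_mono ennreal_leI powr_mono2' Kfun_mono frac_le) auto
      then show "enn_powr (ennreal (t powr (- \<theta>)) * Kf f t) r * ennreal (1 / t) * indicator {0<..<1} t \<le> ?c k"
        by (auto simp: indicator_def)
    qed auto
    also have "\<dots> \<le> (\<Sum>k. ennreal D * (enn_powr (?S k) (r / p) + ennreal (5 powr (r / q)) * enn_powr (?T k) (r / q)))"
    proof (intro suminf_le)
      fix k
      let ?Z = "ennreal (\<rho> k powr (- \<theta>)) * Kf f (\<rho> k)"
      have "\<rho> (Suc k) powr (- \<theta>) \<le> (\<rho> k / M) powr (- \<theta>)"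
        using ratio[of k] \<rho>_pos[of k] M \<theta>
        by (intro powr_mono2') (auto simp: field_simps)
      also have "\<dots> = M powr \<theta> * \<rho> k powr (- \<theta>)"
        by (simp add: powr_divide powr_minus_divide[of _ \<theta>])
      finally have "ennreal (\<rho> (Suc k) powr (- \<theta>)) * Kf f (\<rho> k) \<le> ennreal (M powr \<theta>) * ?Z"
        by (simp add: ennreal_mult'[symmetric] mult.assoc[symmetric] mult_right_mono ennreal_leI)
      from enn_powr_le_cmult[OF this _ r]
      have 1: "enn_powr (ennreal (\<rho> (Suc k) powr (- \<theta>)) * Kf f (\<rho> k)) r \<le> ennreal (M powr (\<theta> * r)) * enn_powr ?Z r"
        by (simp add: powr_powr)
      have "enn_powr ?Z r \<le> enn_powr (enn_powr (?S k) (1 / p) + enn_powr (ennreal 5 * ?T k) (1 / q)) r"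
        using Kfun_dyadic_le[OF f, of k] by (intro enn_powr_mono r) (simp add: x_def y_def)
      also have "\<dots> \<le> ennreal (2 powr r) * (enn_powr (enn_powr (?S k) (1 / p)) r + enn_powr (enn_powr (ennreal 5 * ?T k) (1 / q)) r)"
        by (rule enn_powr_add_le[OF r])
      also have "\<dots> = ennreal (2 powr r) * (enn_powr (?S k) (r / p) + ennreal (5 powr (r / q)) * enn_powr (?T k) (r / q))"
        using pq q r by (simp only: enn_powr_powr enn_powr_mult zero_less_divide_1_iff divide_pos_pos
            times_divide_eq_left mult_1 enn_powr_ennreal zero_le_numeral powr_ge_zero powr_powr)
      finally have 2: "enn_powr ?Z r \<le> ennreal (2 powr r) * (enn_powr (?S k) (r / p) + ennreal (5 powr (r / q)) * enn_powr (?T k) (r / q))" .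
      have "1 / \<rho> (Suc k) * (\<rho> k - \<rho> (Suc k)) \<le> M"
        using ratio[of k] \<rho>_pos[of "Suc k"] by (simp add: field_simps)
      then have 3: "ennreal (1 / \<rho> (Suc k)) * ennreal (\<rho> k - \<rho> (Suc k)) \<le> ennreal M"
        using \<rho>_pos[of "Suc k"] by (simp add: ennreal_mult'[symmetric] ennreal_leI)
      have "?c k * ennreal (\<rho> k - \<rho> (Suc k))
          \<le> (ennreal (M powr (\<theta> * r)) * (ennreal (2 powr r) * (enn_powr (?S k) (r / p) + ennreal (5 powr (r / q)) * enn_powr (?T k) (r / q)))) * ennreal M"
        unfolding mult.assoc[of _ "ennreal (1 / \<rho> (Suc k))"]
        by (intro mult_mono 3 order_trans[OF 1] 2) auto
      also have "\<dots> = ennreal D * (enn_powr (?S k) (r / p) + ennreal (5 powr (r / q)) * enn_powr (?T k) (r / q))"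
        unfolding D_def using M by (simp add: ennreal_mult'' mult_ac)
      finally show "?c k * ennreal (\<rho> k - \<rho> (Suc k))
          \<le> ennreal D * (enn_powr (?S k) (r / p) + ennreal (5 powr (r / q)) * enn_powr (?T k) (r / q))" .
    qed auto
    also have "\<dots> = ennreal D * ((\<Sum>k. enn_powr (?S k) (r / p)) + ennreal (5 powr (r / q)) * (\<Sum>k. enn_powr (?T k) (r / q)))"
      by (simp add: suminf_add[symmetric])
    also have "\<dots> \<le> ennreal D * (ennreal Hx * ?B + ennreal (5 powr (r / q)) * (ennreal Hy * ?B))"
      unfolding Hx_def Hy_def
      by (intro mult_left_mono add_mono discrete_Hardy x y r pq q b_nonneg f) auto
    also have "\<dots> = ennreal D * (ennreal (Hx + 5 powr (r / q) * Hy) * ?B)"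
      using H by (simp add: ennreal_mult'' distrib_right mult.assoc)
    \<comment> \<open>Only nonnegativity of \<open>Hx\<close> and \<open>Hy\<close> has been
      recorded; adding 1 makes the final constant positive.\<close>
    also have "\<dots> \<le> ennreal D * (ennreal (Hx + 5 powr (r / q) * Hy + 1) * ?B)"
      by (intro mult_left_mono mult_right_mono ennreal_leI) auto
    also have "\<dots> = ennreal (D * (Hx + 5 powr (r / q) * Hy + 1)) * ?B"
      using M H by (subst ennreal_mult) (auto simp: D_def mult.assoc)
    finally show ?thesis .
  qed
  moreover have "0 < D * (Hx + 5 powr (r / q) * Hy + 1)"
    using M H by (intro mult_pos_pos add_nonneg_pos add_nonneg_nonneg) (auto simp: D_def)
  ultimately show ?thesis using that by blast
qed

end

section \<open>Equality of the spaces and equivalence of the norms\<close>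

theorem theorem1p2:
  fixes \<Omega> :: "'a::euclidean_space set"
    and \<theta> r \<alpha> p q p\<theta> :: real
  assumes "open \<Omega>" and "bounded \<Omega>" and "emeasure lebesgue \<Omega> = 1"
    and "0 < \<theta>" and "\<theta> < 1" and "1 \<le> r" and "0 < \<alpha>"
    and "1 < p" and "p < q"
    and "1 / p\<theta> = (1 - \<theta>) / p + \<theta> / q"
  shows "interp_space \<Omega> (grand_space \<Omega> p \<alpha>) (grand_norm \<Omega> p \<alpha>)
                       (grand_space \<Omega> q \<alpha>) (grand_norm \<Omega> q \<alpha>) \<theta> r
           = LZ_space \<Omega> p\<theta> r (- \<alpha> / p\<theta>)
       \<and> (\<exists>c C. 0 < c \<and> 0 < C \<and>
           (\<forall>g \<in> LZ_space \<Omega> p\<theta> r (- \<alpha> / p\<theta>).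
              ennreal c * LZ_norm \<Omega> p\<theta> r (- \<alpha> / p\<theta>) g
                \<le> interp_norm \<Omega> (grand_space \<Omega> p \<alpha>) (grand_norm \<Omega> p \<alpha>)
                                 (grand_space \<Omega> q \<alpha>) (grand_norm \<Omega> q \<alpha>) \<theta> r g
              \<and> interp_norm \<Omega> (grand_space \<Omega> p \<alpha>) (grand_norm \<Omega> p \<alpha>)
                                 (grand_space \<Omega> q \<alpha>) (grand_norm \<Omega> q \<alpha>) \<theta> r g
                \<le> ennreal C * LZ_norm \<Omega> p\<theta> r (- \<alpha> / p\<theta>) g))"
proof -
  interpret grand_couple \<Omega> \<theta> r \<alpha> p q p\<theta>
    using assms by unfold_locales (auto intro: lmeasurable_open fmeasurableD)
  let ?X = "grand_space \<Omega> p \<alpha>" and ?Y = "grand_space \<Omega> q \<alpha>"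
  let ?LZ = "LZ_norm \<Omega> p\<theta> r (- \<alpha> / p\<theta>)"
  let ?IN = "interp_norm \<Omega> ?X (grand_norm \<Omega> p \<alpha>) ?Y (grand_norm \<Omega> q \<alpha>) \<theta> r"
  define I where "I g = (\<integral>\<^sup>+t\<in>{0<..<1}. ennreal ((t powr (1 / p\<theta>) * (1 - ln t) powr (- \<alpha> / p\<theta>) * rearr \<Omega> g t) powr r / t) \<partial>lborel)" for g
  have LZ: "?LZ g = enn_powr (I g) (1 / r)" for g
    by (simp add: LZ_norm_def I_def)
  have IN: "?IN g = enn_powr (interp_integral g) (1 / r)" for g
    by (simp add: interp_norm_def interp_integral_def)
  define C1 where "C1 = 2 * 2 powr (2 * (1 + \<alpha>) * r / p\<theta>)"
  define C2 where "C2 = 2 powr (3 * (1 + \<alpha>) * r / p) / (1 - 2 powr (- \<kappa>))"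
  obtain C3 where C3: "0 < C3" "\<And>f. f \<in> meas_on \<Omega> \<Longrightarrow> interp_integral f \<le> ennreal C3 * (\<Sum>k. ennreal (b f k powr r))"
    by (rule interp_integral_le) blast
  have C12: "0 < C1" "0 < C2"
    using \<kappa>_pos powr_less_mono[of "- \<kappa>" 0 2] by (auto simp: C1_def C2_def)
  have lower: "?LZ g \<le> ennreal (C2 powr (1 / r)) * ?IN g" if g: "g \<in> meas_on \<Omega>" for g
  proof -
    have "I g \<le> ennreal C2 * interp_integral g"
      using LZ_integral_le[OF g \<alpha> p\<theta>_pos r] interp_integral_ge[OF g]
      unfolding I_def C2_def b_def by (rule order_trans)
    then show ?thesis
      unfolding LZ IN using C12 r by (intro enn_powr_le_cmult) auto
  qed
  have upper: "?IN g \<le> ennreal ((C3 * C1) powr (1 / r)) * ?LZ g" if g: "g \<in> meas_on \<Omega>" for g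
  proof -
    have "interp_integral g \<le> ennreal C3 * (ennreal C1 * I g)"
      using C3(2)[OF g] LZ_integral_ge[OF g \<alpha> p\<theta>_pos r]
      unfolding I_def C1_def b_def by (meson mult_left_mono order_trans zero_le)
    also have "\<dots> = ennreal (C3 * C1) * I g"
      using C3 C12 by (simp add: ennreal_mult mult.assoc)
    finally show ?thesis
      unfolding LZ IN using C12 C3 r by (intro enn_powr_le_cmult) auto
  qed
  \<comment> \<open>Outside the sum space the infimum runs over the empty set, so K is
    \<open>top\<close> throughout and the integral diverges. Finiteness of the norm thus yields a
    decomposition by itself when a function of the Lorentz-Zygmund space is given.\<close>
  have finite_IN: "g \<in> sum_space \<Omega> ?X ?Y" if "?IN g < top" for g
  proof (rule ccontr)
    assume "g \<notin> sum_space \<Omega> ?X ?Y"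
    then have "{(g0, g1). g0 \<in> ?X \<and> g1 \<in> ?Y \<and> (\<forall>x\<in>\<Omega>. g x = g0 x + g1 x)} = {}"
      by (auto simp: sum_space_def)
    then have K: "Kf g t = top" for t
      unfolding Kfun_def by (simp only: image_empty Inf_empty)
    have "interp_integral g = (\<integral>\<^sup>+\<tau>. top * indicator {0<..<1} \<tau> \<partial>(lborel :: real measure))"
      unfolding interp_integral_def
      by (intro nn_integral_cong) (auto simp: K indicator_def enn_powr_top ennreal_mult_top ennreal_top_mult)
    then have "interp_integral g = top"
      by (simp add: nn_integral_cmult_indicator)
    then show False using that by (simp add: IN enn_powr_top)
  qed
  \<comment> \<open>A decomposition is prescribed only on \<Omega>, which is the space of
    \<open>lebesgue_on \<Omega>\<close>; values elsewhere do not affect measurability.\<close>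
  have sum_meas: "g \<in> meas_on \<Omega>" if g: "g \<in> sum_space \<Omega> ?X ?Y" for g
  proof -
    obtain g0 g1 where "g0 \<in> borel_measurable (lebesgue_on \<Omega>)" "g1 \<in> borel_measurable (lebesgue_on \<Omega>)"
      and eq: "\<And>x. x \<in> \<Omega> \<Longrightarrow> g x = g0 x + g1 x"
      using g by (auto simp: sum_space_def grand_space_def meas_on_def)
    then have "(\<lambda>x. g0 x + g1 x) \<in> borel_measurable (lebesgue_on \<Omega>)" by measurable
    then show ?thesis
      unfolding meas_on_def using eq
      by (subst measurable_cong[of _ _ "\<lambda>x. g0 x + g1 x"]) (auto simp: space_restrict_space)
  qed
  have "g \<in> interp_space \<Omega> ?X (grand_norm \<Omega> p \<alpha>) ?Y (grand_norm \<Omega> q \<alpha>) \<theta> r \<longleftrightarrow> g \<in> LZ_space \<Omega> p\<theta> r (- \<alpha> / p\<theta>)" for g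
  proof
    assume "g \<in> interp_space \<Omega> ?X (grand_norm \<Omega> p \<alpha>) ?Y (grand_norm \<Omega> q \<alpha>) \<theta> r"
    then have g: "g \<in> meas_on \<Omega>" "?IN g < top"
      using sum_meas by (auto simp: interp_space_def)
    then have "?LZ g < top"
      using lower[OF g(1)] by (intro le_less_trans[OF lower]) (auto simp: ennreal_mult_less_top)
    then show "g \<in> LZ_space \<Omega> p\<theta> r (- \<alpha> / p\<theta>)"
      using g by (simp add: LZ_space_def)
  next
    assume "g \<in> LZ_space \<Omega> p\<theta> r (- \<alpha> / p\<theta>)"
    then have g: "g \<in> meas_on \<Omega>" "?LZ g < top" by (auto simp: LZ_space_def)
    then have "?IN g < top"
      by (intro le_less_trans[OF upper]) (auto simp: ennreal_mult_less_top)
    then show "g \<in> interp_space \<Omega> ?X (grand_norm \<Omega> p \<alpha>) ?Y (grand_norm \<Omega> q \<alpha>) \<theta> r"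
      using finite_IN by (simp add: interp_space_def)
  qed
  moreover have "ennreal (1 / C2 powr (1 / r)) * ?LZ g \<le> ?IN g" if "g \<in> meas_on \<Omega>" for g
  proof -
    have "ennreal (1 / C2 powr (1 / r)) * ?LZ g
        \<le> ennreal (1 / C2 powr (1 / r)) * (ennreal (C2 powr (1 / r)) * ?IN g)"
      by (intro mult_left_mono lower that) auto
    also have "\<dots> = ?IN g"
      using C12 by (simp add: mult.assoc[symmetric] ennreal_mult''[symmetric])
    finally show ?thesis .
  qed
  ultimately show ?thesis
    using upper C12 C3(1)
    by (intro conjI set_eqI exI[of _ "1 / C2 powr (1 / r)"] exI[of _ "(C3 * C1) powr (1 / r)"])
      (auto simp: LZ_space_def)
qed

end
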